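(* Let $m>1$ be an integer and, for integers $n\ge 1$, let $$H_{2n+2m-2}(x)=x^{n+m-1}\left(\sum_{j=0}^{m-1}\left(x^{n+j}+\frac{1}{x^{n+j}}\right)+1\right).$$ Let $LC(H_{2n+2m-2})=\lim_{n\to\infty}C(H_{2n+2m-2})$. Then $$\frac{2}{\pi(2m+1)}\cdot\frac{\sin\frac{(m-1)\pi}{2m}}{\sin\frac{\pi}{2m}}<LC(H_{2n+2m-2})<\frac{2}{6m-\pi}\cdot\frac{\sin\frac{(m-1)\pi}{2m}}{\sin\frac{\pi}{2m}}.$$
   Context: For a polynomial $P$ of degree $d$, $C(P)$ denotes the number of complex zeros of $P$ (counted with multiplicity) whose modulus is different from $1$, divided by $d$. *)

theory Defs
  imports "HOL-Computational_Algebra.Polynomial" Complex_Main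
begin

definition C :: "complex poly \<Rightarrow> real" where
  "C P = real (\<Sum>z | poly P z = 0 \<and> cmod z \<noteq> 1. order z P) / real (degree P)"

(* The polynomial H_{2n+2m-2}, after multiplying the Laurent polynomial out. *)
definition H :: "nat \<Rightarrow> nat \<Rightarrow> complex poly" where
  "H m n = (\<Sum>j=0..m - 1. monom 1 ((n + m - 1) + (n + j)) + monom 1 ((n + m - 1) - (n + j)))
           + monom 1 (n + m - 1)"

lemma poly_H:
  assumes "m \<ge> 1" and "x \<noteq> 0"
  shows "poly (H m n) x = x ^ (n + m - 1) * ((\<Sum>j=0..m - 1. x ^ (n + j) + 1 / x ^ (n + j)) + 1)"
proof -
  have "x ^ ((n + m - 1) - (n + j)) = x ^ (n + m - 1) * (1 / x ^ (n + j))" if "j \<in> {0..m - 1}" for j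
  proof -
    have "n + j \<le> n + m - 1" using that assms(1) by auto
    then have "x ^ (n + m - 1) = x ^ ((n + m - 1) - (n + j)) * x ^ (n + j)"
      by (simp only: power_add[symmetric] le_add_diff_inverse2)
    then show ?thesis using assms(2) by (simp only: times_divide_eq_right mult_1_right) simp
  qed
  then have "(\<Sum>j=0..m - 1. x ^ ((n + m - 1) + (n + j)) + x ^ ((n + m - 1) - (n + j))) =
        (\<Sum>j=0..m - 1. x ^ (n + m - 1) * (x ^ (n + j) + 1 / x ^ (n + j)))"
    by (intro sum.cong refl) (simp only: power_add distrib_left)
  then show ?thesis
    unfolding H_def poly_add poly_sum poly_monom by (simp add: sum_distrib_left distrib_left)
qed

lemma degree_H:
  assumes "m \<ge> 1" and "n \<ge> 1"
  shows "degree (H m n) = 2 * n + 2 * m - 2"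
proof (rule antisym)
  show "degree (H m n) \<le> 2 * n + 2 * m - 2"
    unfolding H_def using assms
    by (intro degree_add_le degree_sum_le order.trans[OF degree_monom_le]) auto
  have "coeff (H m n) (2 * n + 2 * m - 2) =
      (\<Sum>j=0..m - 1. if j = m - 1 then 1 else 0)"
  proof -
    have "(if (n + m - 1) + (n + j) = 2 * n + 2 * m - 2 then 1 else 0) +
          (if (n + m - 1) - (n + j) = 2 * n + 2 * m - 2 then 1 else 0) =
          (if j = m - 1 then 1 else (0::complex))" if "j \<in> {0..m - 1}" for j
      using that assms by auto
    moreover have "n + m - 1 \<noteq> 2 * n + 2 * m - 2"
      using assms by linarith
    ultimately show ?thesis
      unfolding H_def coeff_add coeff_sum coeff_monom by (auto intro!: sum.cong)
  qed
  also have "\<dots> = 1" by simp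
  finally show "2 * n + 2 * m - 2 \<le> degree (H m n)"
    by (intro le_degree) simp
qed

definition LC :: "nat \<Rightarrow> real" where
  "LC m = lim (\<lambda>n. C (H m n))"

end

theory Submission
  imports Defs "HOL-Analysis.Analysis" "HOL-Computational_Algebra.Fundamental_Theorem_Algebra"
begin

text \<open>
  On the unit circle \<open>x = exp (2 i u)\<close>, the polynomial is, up to a unimodular factor, the real function
  \<open>2 D(u) cos (M u) + 1\<close>, where \<open>M = 2n + m - 1\<close> and \<open>D(u) = sin (m u) / sin u\<close>. Cut \<open>[0, \<pi>)\<close> into \<open>M\<close>
  cells of length \<open>\<pi>/M\<close>. For large \<open>n\<close>, a cell near a point with \<open>2|D| > 1\<close> contains exactly one zero, which
  is simple, a cell near a point with \<open>2|D| < 1\<close> contains none, and by Rolle's theorem every cell contains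
  boundedly many. Dominated convergence shows that the proportion of zeros off the circle tends to
  \<open>1/\<pi>\<close> times the measure of \<open>{u. 2|sin (m u)| < sin u}\<close>. Near \<open>c = k \<pi>/m\<close> the Lipschitz bound for
  the sine gives an interval inside this set, and the tangent of the sine at \<open>c\<close> together with its chord
  over \<open>[0, \<pi>/6]\<close> gives an interval around it. Finally \<open>\<Sum>k. sin (k \<pi>/m) = cot (\<pi>/(2m))\<close>.
\<close>

section \<open>Multiplicities along the unit circle\<close>

text \<open>Functions of the form \<open>cis (- (k * u)) * poly p (cis (2 * u))\<close> are closed
  under differentiation in \<open>u\<close>. This is the operator induced on \<open>p\<close>,
  through which vanishing derivatives on the circle become statements about polynomial
  roots.\<close>

definition circle_deriv :: "real \<Rightarrow> complex poly \<Rightarrow> complex poly" where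
  "circle_deriv k p = smult (- \<i> * of_real k) p + smult (2 * \<i>) (pCons 0 (pderiv p))"

lemma has_vector_derivative_circle:
  "((\<lambda>u. cis (- (k * u)) * poly p (cis (2 * u))) has_vector_derivative
    cis (- (k * u)) * poly (circle_deriv k p) (cis (2 * u))) (at u)"
proof -
  have c: "((\<lambda>u. cis (a * u)) has_vector_derivative (\<i> * of_real a * cis (a * u))) (at u)" for a u
  proof -
    have "((\<lambda>u::real. exp (of_real u * (\<i> * of_real a))) has_vector_derivative
        exp (of_real u * (\<i> * of_real a)) * (\<i> * of_real a)) (at u)"
      using exp_scaleR_has_vector_derivative_right[of "\<i> * of_real a" u UNIV]
      by (simp add: scaleR_conv_of_real)
    moreover have "exp (of_real u * (\<i> * of_real a)) = cis (a * u)" for u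
      by (simp add: cis_conv_exp mult_ac)
    ultimately show ?thesis by (simp add: mult.commute)
  qed
  have "((poly p \<circ> (\<lambda>u. cis (2 * u))) has_vector_derivative
      (\<i> * of_real 2 * cis (2 * u)) * poly (pderiv p) (cis (2 * u))) (at u)"
    by (intro field_vector_diff_chain_at c poly_DERIV)
  then have p: "((\<lambda>u. poly p (cis (2 * u))) has_vector_derivative
      (\<i> * of_real 2 * cis (2 * u)) * poly (pderiv p) (cis (2 * u))) (at u)"
    by (simp add: o_def)
  have "((\<lambda>u. cis (- k * u) * poly p (cis (2 * u))) has_vector_derivative
      cis (- k * u) * ((\<i> * of_real 2 * cis (2 * u)) * poly (pderiv p) (cis (2 * u)))
      + (\<i> * of_real (- k) * cis (- k * u)) * poly p (cis (2 * u))) (at u)"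
    by (intro has_vector_derivative_mult c p)
  then show ?thesis
    by (simp add: circle_deriv_def algebra_simps)
qed

text \<open>Only the \<open>pderiv\<close> term can lose a linear factor, and by the product rule it
  loses at most one.\<close>

lemma linear_power_dvd_circle_deriv:
  assumes "[:- z, 1:] ^ Suc s dvd p"
  shows "[:- z, 1:] ^ s dvd circle_deriv k p"
proof -
  obtain q where q: "p = [:- z, 1:] ^ Suc s * q" using assms by (elim dvdE)
  have "pderiv p = [:- z, 1:] ^ s * ([:- z, 1:] * pderiv q + smult (of_nat (Suc s)) q)"
    unfolding q pderiv_mult pderiv_power_Suc
    by (simp add: algebra_simps pderiv_pCons)
  then have 1: "[:- z, 1:] ^ s dvd pderiv p" by simp
  have 2: "[:- z, 1:] ^ s dvd p" using assms by (metis dvd_trans le_imp_power_dvd le_SucI order_refl)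
  have "pCons 0 (pderiv p) = pderiv p * [:0, 1:]" by simp
  then have "[:- z, 1:] ^ s dvd pCons 0 (pderiv p)" using 1 by (metis dvd_mult2)
  then show ?thesis unfolding circle_deriv_def using 2 by (intro dvd_add dvd_smult)
qed

text \<open>Vector derivatives are unique. The conclusion has the shape of the first assumption, so
  the lemma can be iterated for higher derivatives.\<close>

lemma real_derivative_circle:
  assumes f: "\<And>u. of_real (f u) = cis (- (k * u)) * poly p (cis (2 * u))"
    and f': "\<And>u. (f has_real_derivative f' u) (at u)"
  shows "of_real (f' u) = cis (- (k * u)) * poly (circle_deriv k p) (cis (2 * u))"
proof -
  have "((\<lambda>u. complex_of_real (f u)) has_vector_derivative of_real (f' u)) (at u)"
    using f'[of u] by (intro has_vector_derivative_of_real) (simp add: has_real_derivative_iff_has_vector_derivative)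
  then show ?thesis
    unfolding f using has_vector_derivative_circle vector_derivative_unique_at by blast
qed

text \<open>A double root of \<open>p\<close> is still a root of \<open>circle_deriv k p\<close>,
  which would make \<open>f'\<close> vanish. The next lemma argues likewise with a triple root and
  two applications of the operator.\<close>

lemma order_le_1_circle:
  assumes f: "\<And>u. of_real (f u) = cis (- (k * u)) * poly p (cis (2 * u))"
    and f': "\<And>u. (f has_real_derivative f' u) (at u)"
    and nz: "f' u \<noteq> 0"
  shows "order (cis (2 * u)) p \<le> 1"
proof (rule ccontr)
  assume "\<not> ?thesis"
  then have "[:- cis (2 * u), 1:] ^ Suc 1 dvd p"
    by (metis Suc_leI dvd_trans le_imp_power_dvd linorder_not_le order_1)
  then have "poly (circle_deriv k p) (cis (2 * u)) = 0"
    using linear_power_dvd_circle_deriv[of "cis (2 * u)" 1] by (simp add: poly_eq_0_iff_dvd)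
  then show False using real_derivative_circle[OF f f', of u] nz by simp
qed

lemma order_le_2_circle:
  assumes f: "\<And>u. of_real (f u) = cis (- (k * u)) * poly p (cis (2 * u))"
    and f': "\<And>u. (f has_real_derivative f' u) (at u)"
    and f'': "\<And>u. (f' has_real_derivative f'' u) (at u)"
    and nz: "f'' u \<noteq> 0"
  shows "order (cis (2 * u)) p \<le> 2"
proof (rule ccontr)
  assume "\<not> ?thesis"
  then have "[:- cis (2 * u), 1:] ^ Suc (Suc 1) dvd p"
    by (metis Suc_1 Suc_leI dvd_trans le_imp_power_dvd linorder_not_le order_1)
  then have "[:- cis (2 * u), 1:] ^ 1 dvd circle_deriv k (circle_deriv k p)"
    by (intro linear_power_dvd_circle_deriv)
  then have "poly (circle_deriv k (circle_deriv k p)) (cis (2 * u)) = 0"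
    by (simp add: poly_eq_0_iff_dvd)
  then show False
    using real_derivative_circle[OF real_derivative_circle[OF f f'] f'', of u] nz by simp
qed

section \<open>The trigonometric form of the polynomials\<close>

text \<open>The function \<open>D\<close> of the overview, written as a cosine sum of Dirichlet
  kernel type: it is smooth everywhere, also where \<open>sin u = 0\<close>, and it can be bounded
  term by term.\<close>

definition dkernel :: "nat \<Rightarrow> real \<Rightarrow> real" where
  "dkernel m u = (\<Sum>j<m. cos ((real m - 1 - 2 * real j) * u))"

definition dkernel_d1 :: "nat \<Rightarrow> real \<Rightarrow> real" where
  "dkernel_d1 m u = (\<Sum>j<m. - (real m - 1 - 2 * real j) * sin ((real m - 1 - 2 * real j) * u))"

definition dkernel_d2 :: "nat \<Rightarrow> real \<Rightarrow> real" where
  "dkernel_d2 m u = (\<Sum>j<m. - (real m - 1 - 2 * real j)\<^sup>2 * cos ((real m - 1 - 2 * real j) * u))"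

lemma dkernel_deriv: "(dkernel m has_real_derivative dkernel_d1 m u) (at u)"
  unfolding dkernel_def dkernel_d1_def
  by (auto intro!: derivative_eq_intros sum.cong simp: algebra_simps)

lemma dkernel_d1_deriv: "(dkernel_d1 m has_real_derivative dkernel_d2 m u) (at u)"
  unfolding dkernel_d1_def dkernel_d2_def
  by (auto intro!: derivative_eq_intros sum.cong simp: power2_eq_square algebra_simps)

lemma isCont_dkernel: "isCont (dkernel m) u"
  using dkernel_deriv DERIV_isCont by blast

lemma dkernel_freq_bound: "j < m \<Longrightarrow> \<bar>real m - 1 - 2 * real j\<bar> \<le> real m"
  by (simp add: abs_le_iff)

text \<open>All \<open>m\<close> frequencies have modulus at most \<open>m\<close>, which gives
  \<open>m ^ 2\<close>. The weaker exponent 3 lets one constant serve for both derivatives and for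
  the Lipschitz bound.\<close>

lemma dkernel_d1_bound: "\<bar>dkernel_d1 m u\<bar> \<le> real m ^ 3"
proof (cases "m = 0")
  case False
  have "\<bar>dkernel_d1 m u\<bar> \<le> (\<Sum>j<m. \<bar>- (real m - 1 - 2 * real j) * sin ((real m - 1 - 2 * real j) * u)\<bar>)"
    unfolding dkernel_d1_def by (rule sum_abs)
  also have "\<dots> \<le> (\<Sum>j<m. real m * 1)"
  proof (intro sum_mono)
    fix j assume "j \<in> {..<m}"
    then show "\<bar>- (real m - 1 - 2 * real j) * sin ((real m - 1 - 2 * real j) * u)\<bar> \<le> real m * 1"
      unfolding abs_mult abs_minus_cancel by (intro mult_mono dkernel_freq_bound) auto
  qed
  also have "\<dots> = real m ^ 2" by (simp add: power2_eq_square)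
  also have "\<dots> \<le> real m ^ 3" using False by (intro power_increasing) auto
  finally show ?thesis .
qed (simp add: dkernel_d1_def)

lemma dkernel_d2_bound: "\<bar>dkernel_d2 m u\<bar> \<le> real m ^ 3"
proof -
  have "\<bar>dkernel_d2 m u\<bar> \<le> (\<Sum>j<m. \<bar>- (real m - 1 - 2 * real j)\<^sup>2 * cos ((real m - 1 - 2 * real j) * u)\<bar>)"
    unfolding dkernel_d2_def by (rule sum_abs)
  also have "\<dots> \<le> (\<Sum>j<m. (real m)\<^sup>2 * 1)"
  proof (intro sum_mono)
    fix j assume "j \<in> {..<m}"
    then have "(real m - 1 - 2 * real j)\<^sup>2 \<le> (real m)\<^sup>2"
      using dkernel_freq_bound[of j m] by (intro power2_le_iff_abs_le[THEN iffD2]) auto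
    then show "\<bar>- (real m - 1 - 2 * real j)\<^sup>2 * cos ((real m - 1 - 2 * real j) * u)\<bar> \<le> (real m)\<^sup>2 * 1"
      by (subst abs_mult, subst abs_minus_cancel) (intro mult_mono, auto)
  qed
  also have "\<dots> = real m ^ 3" by (simp add: power2_eq_square power3_eq_cube)
  finally show ?thesis .
qed

lemma dkernel_lipschitz: "\<bar>dkernel m u - dkernel m v\<bar> \<le> real m ^ 3 * \<bar>u - v\<bar>"
  using field_differentiable_bound[of UNIV "dkernel m" "dkernel_d1 m" "real m ^ 3" u v]
    dkernel_deriv dkernel_d1_bound by (simp add: has_field_derivative_at_within)

text \<open>After doubling, the product formula turns each summand into a difference of sines at
  consecutive frequencies \<open>m - 2 * j\<close>, and the sum telescopes.\<close>

lemma sin_mult_dkernel: "sin u * dkernel m u = sin (real m * u)"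
proof -
  have "2 * (sin u * dkernel m u) = (\<Sum>j<m. sin ((real m - 2 * real j) * u) - sin ((real m - 2 * real (Suc j)) * u))"
    unfolding dkernel_def sum_distrib_left
  proof (intro sum.cong refl)
    fix j
    have "(real m - 2 * real j) * u = (real m - 1 - 2 * real j) * u + u"
      "(real m - 2 * real (Suc j)) * u = (real m - 1 - 2 * real j) * u - u"
      by (simp_all add: algebra_simps)
    then show "2 * (sin u * cos ((real m - 1 - 2 * real j) * u)) =
        sin ((real m - 2 * real j) * u) - sin ((real m - 2 * real (Suc j)) * u)"
      by (simp only: sin_add sin_diff) (simp add: algebra_simps)
  qed
  also have "\<dots> = sin (real m * u) - sin (- (real m * u))"
    by (subst sum_lessThan_telescope') (simp add: algebra_simps)
  finally show ?thesis by simp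
qed

text \<open>The frequency \<open>M\<close> of the overview, which is also the number of cells in
  \<open>{0..<pi}\<close>.\<close>

definition freq :: "nat \<Rightarrow> nat \<Rightarrow> nat" where
  "freq m n = 2 * n + m - 1"

definition trig :: "nat \<Rightarrow> nat \<Rightarrow> real \<Rightarrow> real" where
  "trig m n u = 2 * dkernel m u * cos (real (freq m n) * u) + 1"

definition trig_d1 :: "nat \<Rightarrow> nat \<Rightarrow> real \<Rightarrow> real" where
  "trig_d1 m n u = 2 * dkernel_d1 m u * cos (real (freq m n) * u)
     - 2 * real (freq m n) * dkernel m u * sin (real (freq m n) * u)"

definition trig_d2 :: "nat \<Rightarrow> nat \<Rightarrow> real \<Rightarrow> real" where
  "trig_d2 m n u = 2 * dkernel_d2 m u * cos (real (freq m n) * u)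
     - 4 * real (freq m n) * dkernel_d1 m u * sin (real (freq m n) * u)
     - 2 * (real (freq m n))\<^sup>2 * dkernel m u * cos (real (freq m n) * u)"

lemma trig_deriv: "(trig m n has_real_derivative trig_d1 m n u) (at u)"
  unfolding trig_def trig_d1_def
  by (auto intro!: derivative_eq_intros dkernel_deriv simp: algebra_simps)

lemma trig_d1_deriv: "(trig_d1 m n has_real_derivative trig_d2 m n u) (at u)"
  unfolding trig_d1_def trig_d2_def
  by (auto intro!: derivative_eq_intros dkernel_deriv dkernel_d1_deriv simp: algebra_simps power2_eq_square)

text \<open>The product formula yields the cosines at frequencies \<open>2 * (n + m - 1 - j)\<close>
  and \<open>2 * (n + j)\<close>. Reversing the order of summation shows that both families have the
  same sum.\<close>

lemma dkernel_mult_cos: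
  assumes "m \<ge> 1"
  shows "dkernel m u * cos (real (freq m n) * u) = (\<Sum>j<m. cos (2 * real (n + j) * u))"
proof -
  let ?c = "\<lambda>j. cos (2 * real (n + j) * u)"
  have "2 * (dkernel m u * cos (real (freq m n) * u)) = (\<Sum>j<m. ?c (m - Suc j) + ?c j)"
    unfolding dkernel_def sum_distrib_left sum_distrib_right
  proof (intro sum.cong refl)
    fix j assume "j \<in> {..<m}"
    then have "2 * real (n + (m - Suc j)) * u = (real m - 1 - 2 * real j) * u + real (freq m n) * u"
      "2 * real (n + j) * u = real (freq m n) * u - (real m - 1 - 2 * real j) * u"
      using assms by (simp_all add: freq_def of_nat_diff algebra_simps)
    then show "2 * (cos ((real m - 1 - 2 * real j) * u) * cos (real (freq m n) * u)) = ?c (m - Suc j) + ?c j"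
      by (simp only: cos_add cos_diff) (simp add: algebra_simps)
  qed
  also have "\<dots> = 2 * (\<Sum>j<m. ?c j)"
    unfolding sum.distrib by (subst sum.nat_diff_reindex) simp
  finally show ?thesis by simp
qed

text \<open>At \<open>x = cis (2 * u)\<close> the terms \<open>x ^ (n + j)\<close> and
  \<open>1 / x ^ (n + j)\<close> are conjugate, so removing the unimodular factor
  \<open>x ^ (n + m - 1)\<close> leaves a real number. The multiplicity lemmas apply with
  \<open>k = 2 * (n + m - 1)\<close>.\<close>

lemma trig_conv_poly_H:
  assumes "m \<ge> 1"
  shows "of_real (trig m n u) = cis (- (2 * real (n + m - 1) * u)) * poly (H m n) (cis (2 * u))"
proof -
  have x: "cis (2 * u) ^ k = cis (2 * real k * u)" for k
    by (simp add: Complex.DeMoivre mult_ac)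
  have "(\<Sum>j=0..m - 1. cis (2 * u) ^ (n + j) + 1 / cis (2 * u) ^ (n + j))
      = (\<Sum>j<m. of_real (2 * cos (2 * real (n + j) * u)))"
  proof (intro sum.cong)
    show "{0..m - 1} = {..<m}" using assms by auto
    fix j
    show "cis (2 * u) ^ (n + j) + 1 / cis (2 * u) ^ (n + j) = of_real (2 * cos (2 * real (n + j) * u))"
      unfolding x inverse_eq_divide[symmetric] cis_inverse by (simp add: complex_eq_iff)
  qed
  also have "\<dots> + 1 = of_real (trig m n u)"
    using dkernel_mult_cos[OF assms, of u n] by (simp add: trig_def sum_distrib_left mult.assoc)
  finally have "poly (H m n) (cis (2 * u)) = cis (2 * real (n + m - 1) * u) * of_real (trig m n u)"
    by (subst poly_H[OF assms]) (simp_all add: x)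
  then show ?thesis by (simp add: mult.assoc[symmetric] cis_mult)
qed

lemma H_nonzero: "m \<ge> 1 \<Longrightarrow> H m n \<noteq> 0"
proof
  assume "m \<ge> 1" "H m n = 0"
  then have "poly (H m n) 1 = 0" by simp
  moreover have "poly (H m n) 1 = of_nat (2 * m + 1)"
    using \<open>m \<ge> 1\<close> by (subst poly_H) auto
  ultimately show False by (simp only: of_nat_eq_0_iff)
qed

lemma poly_H_cis_eq_0_iff: "m \<ge> 1 \<Longrightarrow> poly (H m n) (cis (2 * u)) = 0 \<longleftrightarrow> trig m n u = 0"
  using trig_conv_poly_H[of m n u] by (metis cis_neq_zero mult_eq_0_iff of_real_eq_0_iff)

section \<open>Zeros in the cells of the grid\<close>

text \<open>For \<open>S\<close> inside \<open>{0..<pi}\<close> this counts the roots of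
  \<open>H m n\<close> on the corresponding arc, with their multiplicities as polynomial
  roots.\<close>

definition weight :: "nat \<Rightarrow> nat \<Rightarrow> real set \<Rightarrow> nat" where
  "weight m n S = (\<Sum>u | u \<in> S \<and> trig m n u = 0. order (cis (2 * u)) (H m n))"

text \<open>Half-open, so that the cells with \<open>j < freq m n\<close> partition
  \<open>{0..<pi}\<close>. At the ends of a cell \<open>cos (freq m n * u)\<close> takes the values
  1 and -1 in some order.\<close>

definition cell :: "nat \<Rightarrow> nat \<Rightarrow> nat \<Rightarrow> real set" where
  "cell m n j = {real j * pi / real (freq m n) ..< real (Suc j) * pi / real (freq m n)}"

lemma inj_on_cis_double: "inj_on (\<lambda>u. cis (2 * u)) {0..<pi}"
proof (rule inj_onI)
  fix u v assume u: "u \<in> {0..<pi}" and v: "v \<in> {0..<pi}" and eq: "cis (2 * u) = cis (2 * v)"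
  have "cis (2 * u - 2 * v) = 1" using eq by (simp add: cis_divide[symmetric])
  then have "cos (2 * u - 2 * v) = 1" by (metis cis.sel(1) one_complex.sel(1))
  then obtain k where "2 * u - 2 * v = of_int k * 2 * pi" using cos_one_2pi_int by blast
  then have k: "u - v = of_int k * pi" by simp
  then have "\<bar>of_int k * pi\<bar> < pi" using u v unfolding k[symmetric] by (auto simp: abs_less_iff)
  then have "\<bar>real_of_int k\<bar> < 1" by (simp add: abs_mult)
  then have "k = 0" by linarith
  then show "u = v" using k by simp
qed

lemma finite_zeros:
  assumes "m \<ge> 1" "S \<subseteq> {0..<pi}"
  shows "finite {u. u \<in> S \<and> trig m n u = 0}"
proof (rule finite_imageD)
  show "inj_on (\<lambda>u. cis (2 * u)) {u. u \<in> S \<and> trig m n u = 0}"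
    using assms(2) by (intro inj_on_subset[OF inj_on_cis_double]) auto
  show "finite ((\<lambda>u. cis (2 * u)) ` {u. u \<in> S \<and> trig m n u = 0})"
    by (rule finite_subset[OF _ poly_roots_finite[OF H_nonzero[OF assms(1), of n]]])
      (auto simp: poly_H_cis_eq_0_iff[OF assms(1)])
qed

text \<open>Stated as an inequality so that the pieces may overlap, as the thirds of a cell do at
  their common boundary points.\<close>

lemma weight_Un:
  assumes "m \<ge> 1" "S \<subseteq> {0..<pi}" "T \<subseteq> {0..<pi}"
  shows "weight m n (S \<union> T) \<le> weight m n S + weight m n T"
proof -
  have "{u. u \<in> S \<union> T \<and> trig m n u = 0} = {u. u \<in> S \<and> trig m n u = 0} \<union> {u. u \<in> T \<and> trig m n u = 0}"
    by auto
  then show ?thesis unfolding weight_def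
    using finite_zeros[of m S n] finite_zeros[of m T n] assms by (simp add: sum_Un_nat)
qed

section \<open>Zero counts from Rolle's theorem\<close>

lemma Rolle_real_derivative:
  fixes f f' :: "real \<Rightarrow> real"
  assumes "\<And>u. (f has_real_derivative f' u) (at u)" "x < y" "f x = f y"
  shows "\<exists>z. x < z \<and> z < y \<and> f' z = 0"
  using MVT2[of x y f f'] assms by auto

text \<open>Some element remains after removing the minimum and the maximum, and it lies strictly
  between them.\<close>

lemma three_increasing_elements:
  fixes Z :: "'a :: linorder set"
  assumes "finite Z" "card Z > 2"
  shows "\<exists>a\<in>Z. \<exists>b\<in>Z. \<exists>c\<in>Z. a < b \<and> b < c"
proof -
  have ne: "Z \<noteq> {}" using assms by auto
  have "card {Min Z, Max Z} \<le> 2" by (simp add: card_insert_if)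
  then have "Z - {Min Z, Max Z} \<noteq> {}"
    using assms(2) diff_card_le_card_Diff[of "{Min Z, Max Z}" Z] by (metis card.empty diff_is_0_eq finite.emptyI finite_insert le_zero_eq not_le order.trans)
  then obtain b where "b \<in> Z" "b \<noteq> Min Z" "b \<noteq> Max Z" by auto
  moreover have "Min Z \<le> b" "b \<le> Max Z" using assms(1) \<open>b \<in> Z\<close> by auto
  ultimately show ?thesis using Min_in[OF assms(1) ne] Max_in[OF assms(1) ne]
    by (metis order_le_less)
qed

lemma zero_free_derivative_imp_inj:
  fixes f f' :: "real \<Rightarrow> real"
  assumes "is_interval S" and d: "\<And>u. (f has_real_derivative f' u) (at u)"
    and nz: "\<And>u. u \<in> S \<Longrightarrow> f' u \<noteq> 0"
    and "x \<in> S" "y \<in> S" "f x = f y"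
  shows "x = y"
  using assms(4-)
proof (induction x y rule: linorder_wlog)
  case (le x y)
  show ?case
  proof (rule ccontr)
    assume "x \<noteq> y"
    then have "x < y" using le by simp
    then obtain z where z: "x < z" "z < y" "f' z = 0"
      using Rolle_real_derivative[OF d] le by blast
    then have "z \<in> S" using assms(1) le by (meson is_interval_1 less_imp_le)
    then show False using nz z by blast
  qed
qed metis

text \<open>Rolle's theorem leaves room for one zero only, and the nonzero derivative makes it
  simple.\<close>

lemma weight_le_of_d1:
  assumes "m \<ge> 1" "S \<subseteq> {0..<pi}" "is_interval S" and nz: "\<And>u. u \<in> S \<Longrightarrow> trig_d1 m n u \<noteq> 0"
  shows "weight m n S \<le> 1"
proof -
  let ?Z = "{u. u \<in> S \<and> trig m n u = 0}"
  have "card ?Z \<le> 1"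
    using finite_zeros[OF assms(1,2)] zero_free_derivative_imp_inj[OF assms(3) trig_deriv nz]
    by (intro card_le_Suc0_iff_eq[THEN iffD2, unfolded One_nat_def[symmetric]]) auto
  have "weight m n S \<le> (\<Sum>u\<in>?Z. 1)"
    unfolding weight_def using nz
    by (intro sum_mono order_le_1_circle[OF trig_conv_poly_H[OF assms(1)] trig_deriv]) auto
  then show ?thesis using \<open>card ?Z \<le> 1\<close> by simp
qed

text \<open>Three distinct zeros would give two of \<open>trig_d1\<close> and hence one of
  \<open>trig_d2\<close>. So there are at most two zeros, each of multiplicity at most two.\<close>

lemma weight_le_of_d2:
  assumes "m \<ge> 1" "S \<subseteq> {0..<pi}" "is_interval S" and nz: "\<And>u. u \<in> S \<Longrightarrow> trig_d2 m n u \<noteq> 0"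
  shows "weight m n S \<le> 4"
proof -
  let ?Z = "{u. u \<in> S \<and> trig m n u = 0}"
  have fin: "finite ?Z" by (rule finite_zeros[OF assms(1,2)])
  have "card ?Z \<le> 2"
  proof (rule ccontr)
    assume big: "\<not> card ?Z \<le> 2"
    then obtain a b c where "a < b" "b < c" and abcZ: "a \<in> ?Z" "b \<in> ?Z" "c \<in> ?Z"
      using three_increasing_elements[OF fin] by (auto simp: not_le)
    then obtain v w where vw: "a < v" "v < b" "trig_d1 m n v = 0" "b < w" "w < c" "trig_d1 m n w = 0"
      using Rolle_real_derivative[OF trig_deriv, of a b m n] Rolle_real_derivative[OF trig_deriv, of b c m n] by auto
    then have "v \<in> S" "w \<in> S" using abcZ mem_is_interval_1_I[OF assms(3), of a b v] mem_is_interval_1_I[OF assms(3), of b c w]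
      by auto
    then have "v = w"
      using zero_free_derivative_imp_inj[OF assms(3) trig_d1_deriv nz] vw by metis
    then show False using vw by simp
  qed
  have "weight m n S \<le> (\<Sum>u\<in>?Z. 2)"
    unfolding weight_def using nz
    by (intro sum_mono order_le_2_circle[OF trig_conv_poly_H[OF assms(1)] trig_deriv trig_d1_deriv]) auto
  then show ?thesis using \<open>card ?Z \<le> 2\<close> by simp
qed

section \<open>Position and size of the cells\<close>

lemma freq_pos: "m > 1 \<Longrightarrow> freq m n > 0"
  by (simp add: freq_def)

lemma eventually_freq_ge: "eventually (\<lambda>n. real (freq m n) \<ge> x) sequentially"
proof -
  obtain N where "x \<le> real N" using real_arch_simple by blast
  then have "real (freq m n) \<ge> x" if "n > N" for n
    using that by (simp add: freq_def)
  then show ?thesis unfolding eventually_sequentially by (metis Suc_le_lessD)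
qed

text \<open>Membership in terms of the phase \<open>freq m n * x - j * pi\<close>, which runs once
  through \<open>[0, pi)\<close> along the cell.\<close>

lemma mem_cell_iff:
  assumes "m > 1"
  shows "x \<in> cell m n j \<longleftrightarrow> 0 \<le> real (freq m n) * x - real j * pi \<and> real (freq m n) * x - real j * pi < pi"
  using freq_pos[OF assms, of n] by (auto simp: cell_def field_simps)

lemma cell_subset:
  assumes "m > 1" "j < freq m n"
  shows "cell m n j \<subseteq> {0..<pi}"
proof
  fix x assume x: "x \<in> cell m n j"
  have M: "real (freq m n) > 0" using freq_pos[OF assms(1), of n] by simp
  have "real (Suc j) * pi \<le> real (freq m n) * pi"
    using assms(2) by (intro mult_right_mono) auto
  then have "real (Suc j) * pi / real (freq m n) \<le> pi"
    using M by (simp add: field_simps)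
  moreover have "real j * pi / real (freq m n) \<ge> 0" using M by simp
  ultimately show "x \<in> {0..<pi}" using x unfolding cell_def atLeastLessThan_iff by linarith
qed

lemma cell_diameter:
  assumes "x \<in> cell m n j" "y \<in> cell m n j"
  shows "\<bar>x - y\<bar> \<le> pi / real (freq m n)"
proof -
  have "real (Suc j) * pi / real (freq m n) = real j * pi / real (freq m n) + pi / real (freq m n)"
    by (simp add: algebra_simps add_divide_distrib)
  then show ?thesis using assms by (auto simp: cell_def)
qed

section \<open>Nonvanishing of the derivatives\<close>

lemma cos_ge_half: "\<bar>t\<bar> \<le> pi / 3 \<Longrightarrow> cos t \<ge> 1 / 2" for t :: real
  using cos_monotone_0_pi_le[of "\<bar>t\<bar>" "pi / 3"] by (simp add: cos_60)

lemma abs_cos_diff_npi: "\<bar>cos (x - real j * pi)\<bar> = \<bar>cos x\<bar>"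
  by (simp add: cos_diff abs_mult)

lemma abs_sin_diff_npi: "\<bar>sin (x - real j * pi)\<bar> = \<bar>sin x\<bar>"
  by (simp add: sin_diff abs_mult)

text \<open>The term carrying the factor \<open>freq m n\<close> dominates, since the other one is
  at most \<open>2 * m ^ 3\<close> in modulus.\<close>

lemma trig_d1_nonzero:
  assumes "\<bar>dkernel m u\<bar> \<ge> a" "\<bar>sin (real (freq m n) * u)\<bar> \<ge> s" "a \<ge> 0" "s \<ge> 0"
    and M: "real (freq m n) * a * s > real m ^ 3"
  shows "trig_d1 m n u \<noteq> 0"
proof
  let ?M = "real (freq m n)"
  assume "trig_d1 m n u = 0"
  then have "\<bar>dkernel_d1 m u * cos (?M * u)\<bar> = \<bar>?M * dkernel m u * sin (?M * u)\<bar>"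
    by (simp add: trig_d1_def)
  also have "\<dots> = ?M * (\<bar>dkernel m u\<bar> * \<bar>sin (?M * u)\<bar>)" by (simp add: abs_mult)
  also have "\<dots> \<ge> ?M * (a * s)"
    using assms by (intro mult_left_mono mult_mono) auto
  finally have "?M * (a * s) \<le> \<bar>dkernel_d1 m u * cos (?M * u)\<bar>" .
  also have "\<dots> \<le> real m ^ 3 * 1"
    unfolding abs_mult by (intro mult_mono dkernel_d1_bound) auto
  finally show False using M by simp
qed

text \<open>With \<open>M = freq m n\<close>, half of the leading term is at least
  \<open>M ^ 2 / 8\<close>, and half of the rest is at most \<open>m ^ 3 + 2 * M * m ^ 3\<close>,
  hence at most \<open>3 * M * m ^ 3\<close>. The threshold 32 makes \<open>M ^ 2 / 8\<close> at
  least \<open>4 * M * m ^ 3\<close>.\<close>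

lemma trig_d2_nonzero:
  assumes "\<bar>dkernel m u\<bar> \<ge> 1 / 4" "\<bar>cos (real (freq m n) * u)\<bar> \<ge> 1 / 2"
    and M: "real (freq m n) \<ge> 32 * real m ^ 3" and "m > 1"
  shows "trig_d2 m n u \<noteq> 0"
proof
  let ?M = "real (freq m n)"
  assume "trig_d2 m n u = 0"
  then have "?M\<^sup>2 * dkernel m u * cos (?M * u)
      = dkernel_d2 m u * cos (?M * u) - 2 * (?M * (dkernel_d1 m u * sin (?M * u)))"
    by (simp add: trig_d2_def)
  moreover have "\<bar>?M\<^sup>2 * dkernel m u * cos (?M * u)\<bar> = ?M\<^sup>2 * (\<bar>dkernel m u\<bar> * \<bar>cos (?M * u)\<bar>)"
    by (simp add: abs_mult)
  moreover have "\<dots> \<ge> ?M\<^sup>2 * (1 / 4 * (1 / 2))"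
    using assms by (intro mult_left_mono mult_mono) auto
  moreover have "\<bar>dkernel_d2 m u * cos (?M * u)\<bar> \<le> real m ^ 3 * 1"
    unfolding abs_mult by (intro mult_mono dkernel_d2_bound) auto
  moreover have "\<bar>dkernel_d1 m u * sin (?M * u)\<bar> \<le> real m ^ 3 * 1"
    unfolding abs_mult by (intro mult_mono dkernel_d1_bound) auto
  then have "\<bar>?M * (dkernel_d1 m u * sin (?M * u))\<bar> \<le> ?M * real m ^ 3"
    unfolding abs_mult[of ?M] abs_of_nat by (intro mult_left_mono) auto
  ultimately have "?M\<^sup>2 / 8 \<le> real m ^ 3 + 2 * (?M * real m ^ 3)" by linarith
  moreover have "?M * ?M \<ge> ?M * (32 * real m ^ 3)" using M by (intro mult_left_mono) auto
  moreover have "?M * real m ^ 3 \<ge> 1 * real m ^ 3"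
    using freq_pos[OF assms(4), of n] by (intro mult_right_mono) auto
  moreover have "real m ^ 3 > 0" using assms(4) by simp
  ultimately show False unfolding power2_eq_square by linarith
qed

section \<open>Zero counts in a single cell\<close>

lemma abs_dkernel_mult_cos_of_zero:
  assumes "trig m n u = 0"
  shows "2 * \<bar>dkernel m u\<bar> * \<bar>cos (real (freq m n) * u)\<bar> = 1"
proof -
  have "2 * dkernel m u * cos (real (freq m n) * u) = - 1"
    using assms by (simp add: trig_def)
  then have "\<bar>2 * dkernel m u * cos (real (freq m n) * u)\<bar> = 1" by simp
  then show ?thesis by (simp add: abs_mult)
qed

text \<open>A zero forces the kernel to have modulus at least 1/2 there, hence at least 1/4 on the
  whole short cell. The cell is cut into thirds by phase: on the outer two the cosine is large and
  \<open>trig_d2\<close> has no zero, on the middle one the sine is large and \<open>trig_d1\<close>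
  has none. The total is 4 + 1 + 4. The uniform bound later serves as the majorant for dominated
  convergence.\<close>

lemma weight_cell_le:
  assumes m: "m > 1" and M: "real (freq m n) \<ge> 32 * real m ^ 3" and j: "j < freq m n"
  shows "weight m n (cell m n j) \<le> 9"
proof (cases "\<exists>v\<in>cell m n j. trig m n v = 0")
  case False
  then have "{u. u \<in> cell m n j \<and> trig m n u = 0} = {}" by auto
  then show ?thesis by (simp only: weight_def) simp
next
  case True
  let ?M = "real (freq m n)"
  define A where "A = real m ^ 3"
  have A: "A > 0" using m by (simp add: A_def)
  have Mpos: "?M > 0" using freq_pos[OF m, of n] by simp
  from True obtain v where v: "v \<in> cell m n j" "trig m n v = 0" by blast
  have "2 * \<bar>dkernel m v\<bar> * \<bar>cos (?M * v)\<bar> \<le> 2 * \<bar>dkernel m v\<bar> * 1"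
    by (intro mult_left_mono) auto
  then have Dv: "\<bar>dkernel m v\<bar> \<ge> 1 / 2" using abs_dkernel_mult_cos_of_zero[OF v(2)] by simp
  have D: "\<bar>dkernel m u\<bar> \<ge> 1 / 4" if "u \<in> cell m n j" for u
  proof -
    have "\<bar>dkernel m u - dkernel m v\<bar> \<le> A * \<bar>u - v\<bar>" unfolding A_def by (rule dkernel_lipschitz)
    also have "\<dots> \<le> A * (pi / ?M)"
      using A cell_diameter[OF that v(1)] by (intro mult_left_mono) auto
    also have "\<dots> \<le> 1 / 4"
    proof -
      have "4 * (A * pi) \<le> 4 * (A * 4)" using A pi_less_4 by (intro mult_left_mono) auto
      then have "4 * (A * pi) \<le> ?M" using M A unfolding A_def by linarith
      then show ?thesis using Mpos by (simp add: field_simps)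
    qed
    finally show ?thesis using Dv by linarith
  qed
  define \<theta> where "\<theta> u = ?M * u - real j * pi" for u
  have \<theta>: "0 \<le> \<theta> u \<and> \<theta> u < pi" if "u \<in> cell m n j" for u
    using that mem_cell_iff[OF m] by (simp add: \<theta>_def)
  define S1 where "S1 = {u \<in> cell m n j. \<theta> u \<le> pi / 3}"
  define S2 where "S2 = {u \<in> cell m n j. pi / 3 \<le> \<theta> u \<and> \<theta> u \<le> 2 * pi / 3}"
  define S3 where "S3 = {u \<in> cell m n j. 2 * pi / 3 \<le> \<theta> u}"
  have mono: "\<theta> x \<le> \<theta> y" if "x \<le> y" for x y
    using that Mpos by (simp add: \<theta>_def)
  have S: "cell m n j = S1 \<union> (S2 \<union> S3)" by (auto simp: S1_def S2_def S3_def)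
  have int: "is_interval S1" "is_interval S2" "is_interval S3"
    unfolding is_interval_1 S1_def S2_def S3_def cell_def
    using mono
    by (auto simp del: le_divide_eq_numeral1 divide_le_eq_numeral1 intro: order.trans order.strict_trans1)
  have sub: "S1 \<subseteq> cell m n j" "S2 \<subseteq> cell m n j" "S3 \<subseteq> cell m n j"
    by (auto simp: S1_def S2_def S3_def)
  note sub' = sub[THEN order.trans, OF cell_subset[OF m j]]
  have m1: "m \<ge> 1" using m by simp
  have "weight m n S1 \<le> 4"
  proof (rule weight_le_of_d2[OF m1 sub'(1) int(1)])
    fix u assume u: "u \<in> S1"
    have "cos (\<theta> u) \<ge> 1 / 2" using u \<theta> by (intro cos_ge_half) (auto simp: S1_def)
    then have "\<bar>cos (?M * u)\<bar> \<ge> 1 / 2"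
      unfolding abs_cos_diff_npi[of "?M * u" j, symmetric] \<theta>_def by simp
    then show "trig_d2 m n u \<noteq> 0" using D u sub m M by (intro trig_d2_nonzero) auto
  qed
  moreover have "weight m n S3 \<le> 4"
  proof (rule weight_le_of_d2[OF m1 sub'(3) int(3)])
    fix u assume u: "u \<in> S3"
    have "\<bar>pi - \<theta> u\<bar> \<le> pi / 3" using u \<theta>[of u] by (simp add: S3_def)
    then have "cos (pi - \<theta> u) \<ge> 1 / 2" by (intro cos_ge_half)
    then have "\<bar>cos (\<theta> u)\<bar> \<ge> 1 / 2" by (simp add: cos_diff)
    then have "\<bar>cos (?M * u)\<bar> \<ge> 1 / 2"
      unfolding abs_cos_diff_npi[of "?M * u" j, symmetric] \<theta>_def by simp
    then show "trig_d2 m n u \<noteq> 0" using D u sub m M by (intro trig_d2_nonzero) auto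
  qed
  moreover have "weight m n S2 \<le> 1"
  proof (rule weight_le_of_d1[OF m1 sub'(2) int(2)])
    fix u assume u: "u \<in> S2"
    have "pi / 3 \<le> \<theta> u" "\<theta> u \<le> 2 * pi / 3" using u unfolding S2_def by auto
    then have "\<bar>pi / 2 - \<theta> u\<bar> \<le> pi / 3" using pi_gt_zero by linarith
    then have "cos (pi / 2 - \<theta> u) \<ge> 1 / 2" by (intro cos_ge_half)
    then have "\<bar>sin (\<theta> u)\<bar> \<ge> 1 / 2" by (simp add: cos_diff)
    then have "\<bar>sin (?M * u)\<bar> \<ge> 1 / 2"
      unfolding abs_sin_diff_npi[of "?M * u" j, symmetric] \<theta>_def by simp
    moreover have "?M * (1 / 4) * (1 / 2) > real m ^ 3" using M A unfolding A_def by linarith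
    ultimately show "trig_d1 m n u \<noteq> 0"
      using D u sub by (intro trig_d1_nonzero[where a = "1/4" and s = "1/2"]) auto
  qed
  moreover have "weight m n (cell m n j) \<le> weight m n S1 + (weight m n S2 + weight m n S3)"
    unfolding S using weight_Un[OF m1, of S1 "S2 \<union> S3" n] weight_Un[OF m1, of S2 S3 n] sub' by simp
  ultimately show ?thesis by linarith
qed

text \<open>A zero needs kernel modulus at least 1/2, but across a short cell the kernel changes by
  less than its distance \<open>\<eta>\<close> from that level. The cell around \<open>u\<close>
  moves with \<open>n\<close>, hence the quantifier over \<open>j\<close> inside.\<close>

lemma weight_cell_eventually_0:
  assumes m: "m > 1" and u: "2 * \<bar>dkernel m u\<bar> < 1"
  shows "eventually (\<lambda>n. \<forall>j. u \<in> cell m n j \<longrightarrow> weight m n (cell m n j) = 0) sequentially"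
proof -
  define \<eta> where "\<eta> = 1 / 2 - \<bar>dkernel m u\<bar>"
  have \<eta>: "\<eta> > 0" using u by (simp add: \<eta>_def)
  have A: "real m ^ 3 > 0" using m by simp
  show ?thesis
    using eventually_freq_ge[of "8 * real m ^ 3 / \<eta>" m]
  proof eventually_elim
    case (elim n)
    let ?M = "real (freq m n)"
    have Mpos: "?M > 0" using freq_pos[OF m, of n] by simp
    have "trig m n v \<noteq> 0" if v: "v \<in> cell m n j" and u: "u \<in> cell m n j" for v j
    proof
      assume "trig m n v = 0"
      then have "2 * \<bar>dkernel m v\<bar> * \<bar>cos (?M * v)\<bar> = 1" by (rule abs_dkernel_mult_cos_of_zero)
      moreover have "2 * \<bar>dkernel m v\<bar> * \<bar>cos (?M * v)\<bar> \<le> 2 * \<bar>dkernel m v\<bar> * 1"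
        by (intro mult_left_mono) auto
      ultimately have "\<bar>dkernel m v\<bar> \<ge> 1 / 2" by simp
      moreover have "\<bar>dkernel m v - dkernel m u\<bar> \<le> real m ^ 3 * (pi / ?M)"
        by (rule order.trans[OF dkernel_lipschitz mult_left_mono[OF cell_diameter[OF v u]]]) simp
      moreover have "real m ^ 3 * (pi / ?M) < \<eta>"
      proof -
        have "real m ^ 3 * pi < real m ^ 3 * 8" using A pi_less_4 by (intro mult_strict_left_mono) auto
        also have "\<dots> \<le> \<eta> * ?M" using elim \<eta> by (simp add: field_simps)
        finally show ?thesis using Mpos by (simp add: field_simps)
      qed
      ultimately show False unfolding \<eta>_def by linarith
    qed
    then have "{v. v \<in> cell m n j \<and> trig m n v = 0} = {}" if "u \<in> cell m n j" for j
      using that by auto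
    then show ?case by (simp add: weight_def del: Collect_empty_eq)
  qed
qed

text \<open>A sign change between the ends of the cell gives a zero. Uniqueness and simplicity
  follow because \<open>trig_d1\<close> cannot vanish between two zeros of the same cell, or at a
  zero.\<close>

lemma weight_cell_eventually_1:
  assumes m: "m > 1" and u: "2 * \<bar>dkernel m u\<bar> > 1"
  shows "eventually (\<lambda>n. \<forall>j<freq m n. u \<in> cell m n j \<longrightarrow> weight m n (cell m n j) = 1) sequentially"
proof -
  define \<eta> where "\<eta> = \<bar>dkernel m u\<bar> - 1 / 2"
  \<comment> \<open>In a short cell around \<open>u\<close>, twice the kernel modulus is at least
    \<open>1 + \<eta>\<close>, so the cosine at a zero has modulus at most \<open>r\<close>, and the
    sine has modulus at least \<open>\<sigma>\<close>.\<close>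
  define r where "r = 1 / (1 + \<eta>)"
  define \<sigma> where "\<sigma> = sqrt (1 - r\<^sup>2)"
  have \<eta>: "\<eta> > 0" using u by (simp add: \<eta>_def)
  have r: "0 < r" "r < 1" using \<eta> by (simp_all add: r_def)
  then have "r\<^sup>2 < 1" by (simp add: abs_square_less_1)
  then have \<sigma>: "\<sigma> > 0" by (simp add: \<sigma>_def)
  have A: "real m ^ 3 > 0" using m by simp
  show ?thesis
    using eventually_freq_ge[of "8 * real m ^ 3 / \<eta>" m] eventually_freq_ge[of "4 * real m ^ 3 / \<sigma>" m]
  proof eventually_elim
    case (elim n)
    let ?M = "real (freq m n)"
    have Mpos: "?M > 0" using freq_pos[OF m, of n] by simp
    have M\<sigma>: "?M * (1 / 2) * \<sigma> > real m ^ 3"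
    proof -
      have "?M * \<sigma> \<ge> 4 * real m ^ 3" using elim(2) \<sigma> by (simp add: field_simps)
      then show ?thesis using A by linarith
    qed
    have close: "\<bar>dkernel m v - dkernel m u\<bar> < \<eta> / 2" if "\<bar>v - u\<bar> \<le> pi / ?M" for v
    proof -
      have "\<bar>dkernel m v - dkernel m u\<bar> \<le> real m ^ 3 * (pi / ?M)"
        by (rule order.trans[OF dkernel_lipschitz mult_left_mono[OF that]]) simp
      also have "\<dots> < \<eta> / 2"
      proof -
        have "real m ^ 3 * pi < real m ^ 3 * 4" using A pi_less_4 by (intro mult_strict_left_mono) auto
        also have "\<dots> \<le> \<eta> / 2 * ?M" using elim(1) \<eta> by (simp add: field_simps)
        finally show ?thesis using Mpos by (simp add: field_simps)
      qed
      finally show ?thesis .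
    qed
    show ?case
    proof (intro allI impI)
      fix j assume j: "j < freq m n" and uj: "u \<in> cell m n j"
      define p where "p = real j * pi / ?M"
      define q where "q = real (Suc j) * pi / ?M"
      have q: "q = p + pi / ?M" by (simp add: p_def q_def algebra_simps add_divide_distrib)
      have cell: "cell m n j = {p..<q}" by (simp add: cell_def p_def q_def)
      have near: "\<bar>v - u\<bar> \<le> pi / ?M" if "p \<le> v" "v \<le> q" for v
        using that uj unfolding cell q by auto
      have pq: "p < q" using q Mpos by simp
      have D: "\<bar>dkernel m v\<bar> \<ge> 1 / 2 + \<eta> / 2" if "p \<le> v" "v \<le> q" for v
        using close[OF near[OF that]] abs_triangle_ineq2[of "dkernel m u" "dkernel m v"]
          abs_minus_commute[of "dkernel m u" "dkernel m v"] unfolding \<eta>_def by argo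
      \<comment> \<open>The cosine is \<open>(- 1) ^ j\<close> at \<open>p\<close> and its negative
        at \<open>q\<close>, while the kernel has the same sign at both ends and modulus above
        1/2.\<close>
      have "\<exists>x\<ge>p. x < q \<and> trig m n x = 0"
      proof -
        have Mp: "?M * p = real j * pi" "?M * q = real (Suc j) * pi"
          using Mpos by (simp_all add: p_def q_def)
        have tp: "trig m n p = 2 * dkernel m p * (- 1) ^ j + 1"
          and tq: "trig m n q = 1 - 2 * dkernel m q * (- 1) ^ j"
          unfolding trig_def Mp by (simp_all only: cos_npi) simp_all
        \<comment> \<open>Both values are within \<open>\<eta> / 2\<close> of
          \<open>dkernel m u\<close>, whose modulus exceeds \<open>\<eta>\<close>.\<close>
        have same: "0 < dkernel m p \<longleftrightarrow> 0 < dkernel m q"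
        proof -
          have "\<bar>dkernel m p - dkernel m u\<bar> < \<eta> / 2" "\<bar>dkernel m q - dkernel m u\<bar> < \<eta> / 2"
            using close[OF near[of p]] close[OF near[of q]] pq by auto
          moreover have "\<bar>dkernel m u\<bar> > \<eta>" by (simp add: \<eta>_def)
          ultimately show ?thesis using \<eta> by argo
        qed
        have big: "\<bar>dkernel m p\<bar> > 1 / 2" "\<bar>dkernel m q\<bar> > 1 / 2"
          using D[of p] D[of q] pq \<eta> by auto
        have s: "(- 1 :: real) ^ j = 1 \<or> (- 1 :: real) ^ j = - 1" by (cases "even j") simp_all
        have cont: "isCont (trig m n) x" for x using trig_deriv DERIV_isCont by blast
        have "trig m n p < 0 \<and> 0 < trig m n q \<or> 0 < trig m n p \<and> trig m n q < 0"
          using s same big unfolding tp tq by (auto simp: abs_if split: if_splits)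
        then show ?thesis
        proof
          assume a: "trig m n p < 0 \<and> 0 < trig m n q"
          then obtain x where "p \<le> x" "x \<le> q" "trig m n x = 0"
            using IVT[of "trig m n" p 0 q] cont pq by auto
          \<comment> \<open>\<open>trig\<close> is nonzero at \<open>q\<close>, so the zero lies in
            the half-open cell.\<close>
          then show ?thesis using a by (metis less_irrefl order_le_less)
        next
          assume a: "0 < trig m n p \<and> trig m n q < 0"
          then obtain x where "p \<le> x" "x \<le> q" "trig m n x = 0"
            using IVT2[of "trig m n" q 0 p] cont pq by auto
          then show ?thesis using a by (metis less_irrefl order_le_less)
        qed
      qed
      then obtain x where x: "x \<in> cell m n j" "trig m n x = 0" by (auto simp: cell)
      define \<theta> where "\<theta> v = ?M * v - real j * pi" for v
      have cos_le: "\<bar>cos (\<theta> v)\<bar> \<le> r" if v: "v \<in> cell m n j" "trig m n v = 0" for v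
      proof -
        have "\<bar>cos (?M * v)\<bar> * (1 + \<eta>) \<le> \<bar>cos (?M * v)\<bar> * (2 * \<bar>dkernel m v\<bar>)"
          using D[of v] v unfolding cell by (intro mult_left_mono) auto
        also have "\<dots> = 1" using abs_dkernel_mult_cos_of_zero[OF v(2)] by (simp add: mult_ac)
        finally show ?thesis unfolding \<theta>_def abs_cos_diff_npi r_def using \<eta> by (simp add: field_simps)
      qed
      \<comment> \<open>The cosine of the phase is monotone on the cell, so between two zeros it
        stays within \<open>[- r, r]\<close> and the sine stays away from 0. The case
        \<open>v = w = y\<close> gives simplicity.\<close>
      have nz: "trig_d1 m n w \<noteq> 0" if v: "v \<in> cell m n j" "trig m n v = 0" and y: "y \<in> cell m n j" "trig m n y = 0"
        and w: "v \<le> w" "w \<le> y" for v w y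
      proof (rule trig_d1_nonzero[where a = "1/2" and s = \<sigma>])
        have wc: "w \<in> cell m n j" using v y w by (auto simp: cell)
        show "\<bar>dkernel m w\<bar> \<ge> 1 / 2" using D[of w] wc \<eta> by (auto simp: cell)
        have \<theta>: "0 \<le> \<theta> v" "\<theta> v \<le> \<theta> w" "\<theta> w \<le> \<theta> y" "\<theta> y \<le> pi"
          using v(1) y(1) w Mpos mem_cell_iff[OF m] by (auto simp: \<theta>_def less_imp_le)
        have "cos (\<theta> w) \<le> cos (\<theta> v)" "cos (\<theta> y) \<le> cos (\<theta> w)"
          using \<theta> by (auto intro!: cos_monotone_0_pi_le)
        then have "\<bar>cos (\<theta> w)\<bar> \<le> r" using cos_le[OF v] cos_le[OF y] by linarith
        then have "(cos (?M * w))\<^sup>2 \<le> r\<^sup>2"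
          unfolding \<theta>_def abs_cos_diff_npi using r by (intro power2_le_iff_abs_le[THEN iffD2]) auto
        then have "1 - r\<^sup>2 \<le> (sin (?M * w))\<^sup>2" by (simp add: sin_squared_eq)
        then show "\<sigma> \<le> \<bar>sin (?M * w)\<bar>" unfolding \<sigma>_def
          by (metis real_sqrt_abs real_sqrt_le_iff)
        show "real m ^ 3 < ?M * (1 / 2) * \<sigma>" by (rule M\<sigma>)
      qed (use \<sigma> in auto)
      have uniq: "v = y" if v: "v \<in> cell m n j" "trig m n v = 0" and y: "y \<in> cell m n j" "trig m n y = 0" for v y
      proof (rule ccontr)
        assume "v \<noteq> y"
        then consider "v < y" | "y < v" by linarith
        then show False
        proof cases
          case 1
          then show ?thesis using Rolle_real_derivative[OF trig_deriv 1, of m n] nz[OF v y] v y by auto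
        next
          case 2
          then show ?thesis using Rolle_real_derivative[OF trig_deriv 2, of m n] nz[OF y v] v y by auto
        qed
      qed
      have "{v. v \<in> cell m n j \<and> trig m n v = 0} = {x}" using x uniq by auto
      then have "weight m n (cell m n j) = order (cis (2 * x)) (H m n)" by (simp add: weight_def)
      moreover have "order (cis (2 * x)) (H m n) \<le> 1"
        using m by (intro order_le_1_circle[OF trig_conv_poly_H trig_deriv] nz[OF x x]) auto
      moreover have "order (cis (2 * x)) (H m n) \<noteq> 0"
        using x(2) m by (metis H_nonzero less_imp_le order_root poly_H_cis_eq_0_iff)
      ultimately show "weight m n (cell m n j) = 1" by linarith
    qed
  qed
qed

section \<open>The limiting density\<close>

text \<open>Up to a unimodular factor, \<open>2 * dkernel m u - s\<close> is a polynomial in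
  \<open>cis u\<close>, nonzero because its value at 1 is \<open>2 * m - s\<close>. These levels are
  the points where pointwise convergence below is left open.\<close>

lemma finite_dkernel_level:
  fixes s :: real
  assumes "m > 1" and s: "\<bar>s\<bar> = 1"
  shows "finite {u \<in> {0..<pi}. 2 * dkernel m u = s}"
proof -
  define P :: "complex poly" where
    "P = (\<Sum>j<m. monom 1 (2 * (m - Suc j)) + monom 1 (2 * j)) - monom (of_real s) (m - 1)"
  have "poly P 1 = of_real (2 * real m - s)"
    by (simp add: P_def poly_sum poly_monom)
  moreover have "2 * real m - s \<noteq> 0" using assms by linarith
  ultimately have "poly P 1 \<noteq> 0" by (metis of_real_eq_0_iff)
  then have "P \<noteq> 0" by auto
  then have fin: "finite {z. poly P z = 0}" by (rule poly_roots_finite)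
  have root: "poly P (cis u) = cis (real (m - 1) * u) * of_real (2 * dkernel m u - s)" for u
  proof -
    have "cis u ^ (2 * (m - Suc j)) + cis u ^ (2 * j)
        = cis (real (m - 1) * u) * of_real (2 * cos ((real m - 1 - 2 * real j) * u))" if "j < m" for j
    proof -
      have "of_real (2 * cos t) = cis t + cis (- t)" for t by (simp add: complex_eq_iff)
      then show ?thesis
        using that by (simp add: Complex.DeMoivre distrib_left cis_mult of_nat_diff algebra_simps)
    qed
    then have "(\<Sum>j<m. cis u ^ (2 * (m - Suc j)) + cis u ^ (2 * j))
        = (\<Sum>j<m. cis (real (m - 1) * u) * of_real (2 * cos ((real m - 1 - 2 * real j) * u)))"
      by (intro sum.cong) auto
    also have "\<dots> = cis (real (m - 1) * u) * of_real (2 * dkernel m u)"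
      by (simp add: dkernel_def sum_distrib_left)
    finally show ?thesis
      by (simp add: P_def poly_sum poly_monom Complex.DeMoivre algebra_simps)
  qed
  show ?thesis
  proof (rule finite_imageD)
    show "finite (cis ` {u \<in> {0..<pi}. 2 * dkernel m u = s})"
      by (rule finite_subset[OF _ fin]) (auto simp: root)
    show "inj_on cis {u \<in> {0..<pi}. 2 * dkernel m u = s}"
    proof (rule inj_onI)
      fix u v assume *: "u \<in> {u \<in> {0..<pi}. 2 * dkernel m u = s}" "v \<in> {u \<in> {0..<pi}. 2 * dkernel m u = s}"
        and "cis u = cis v"
      then have "cis (2 * u) = cis (2 * v)"
        by (metis cis_mult mult_2)
      then show "u = v" using inj_on_cis_double * by (auto dest: inj_onD)
    qed
  qed
qed

text \<open>Where the amplitude of the oscillation is below 1, so that the surrounding cells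
  eventually contain no zero. Its measure divided by \<open>pi\<close> will be the limit of
  \<open>C\<close>.\<close>

definition gap_set :: "nat \<Rightarrow> real set" where
  "gap_set m = {u \<in> {0..<pi}. 2 * \<bar>dkernel m u\<bar> < 1}"

lemma gap_set_measurable [measurable]: "gap_set m \<in> sets borel"
proof -
  have [measurable]: "dkernel m \<in> borel_measurable borel"
    by (intro borel_measurable_continuous_onI continuous_at_imp_continuous_on ballI isCont_dkernel)
  show ?thesis unfolding gap_set_def by measurable
qed

section \<open>The zero count as an integral over the cells\<close>

lemma exists_cell:
  assumes "m > 1" "u \<in> {0..<pi}"
  shows "\<exists>j<freq m n. u \<in> cell m n j"
proof -
  let ?M = "real (freq m n)"
  have M: "?M > 0" using freq_pos[OF assms(1), of n] by simp
  define j where "j = nat \<lfloor>?M * u / pi\<rfloor>"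
  have "?M * u / pi \<ge> 0" using assms M by simp
  then have "real j \<le> ?M * u / pi" "?M * u / pi < real j + 1"
    unfolding j_def by linarith+
  then have j: "real j * pi \<le> ?M * u" "?M * u < real j * pi + pi"
    by (simp_all add: field_simps)
  then have "u \<in> cell m n j" unfolding mem_cell_iff[OF assms(1)] by simp
  moreover have "real j * pi < ?M * pi"
    using j(1) assms(2) M by (meson atLeastLessThan_iff mult_strict_left_mono order_le_less_trans)
  then have "j < freq m n" by simp
  ultimately show ?thesis by blast
qed

lemma cell_unique:
  assumes "m > 1" "u \<in> cell m n i" "u \<in> cell m n j"
  shows "i = j"
proof -
  let ?x = "real (freq m n) * u"
  have *: "real i * pi \<le> ?x" "?x < real i * pi + pi" "real j * pi \<le> ?x" "?x < real j * pi + pi"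
    using assms(2,3) unfolding mem_cell_iff[OF assms(1)] by auto
  then have "real i * pi < (real j + 1) * pi" "real j * pi < (real i + 1) * pi"
    by (simp_all only: distrib_right mult_1)
  then have "real i < real j + 1" "real j < real i + 1"
    by (simp_all only: mult_less_cancel_right_pos pi_gt_zero)
  then show ?thesis by linarith
qed

lemma weight_total:
  assumes "m > 1"
  shows "weight m n {0..<pi} = (\<Sum>j<freq m n. weight m n (cell m n j))"
proof -
  have "{u. u \<in> {0..<pi} \<and> trig m n u = 0} = (\<Union>j\<in>{..<freq m n}. {u. u \<in> cell m n j \<and> trig m n u = 0})"
    (is "?Z = (\<Union>j\<in>_. ?Zj j)")
  proof (intro equalityI subsetI)
    fix u assume u: "u \<in> ?Z"
    then obtain j where "j < freq m n" "u \<in> cell m n j" using exists_cell[OF assms] by blast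
    then show "u \<in> (\<Union>j\<in>{..<freq m n}. ?Zj j)" using u by blast
  next
    fix u assume "u \<in> (\<Union>j\<in>{..<freq m n}. ?Zj j)"
    then obtain j where "j < freq m n" "u \<in> ?Zj j" by blast
    then show "u \<in> ?Z" using cell_subset[OF assms, of j n] by blast
  qed
  moreover have "finite (?Zj j)" if "j < freq m n" for j
    using finite_zeros[OF _ cell_subset[OF assms that]] assms by simp
  moreover have "?Zj i \<inter> ?Zj j = {}" if "i \<noteq> j" for i j
    using cell_unique[OF assms] that by blast
  ultimately show ?thesis
    unfolding weight_def by (simp only:) (rule sum.UNION_disjoint, simp_all)
qed

lemma measure_cell:
  assumes "m > 1"
  shows "measure lborel (cell m n j) = pi / real (freq m n)"
proof -
  have "real (Suc j) * pi / real (freq m n) - real j * pi / real (freq m n) = pi / real (freq m n)"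
    by (simp add: algebra_simps add_divide_distrib)
  moreover have "real j * pi / real (freq m n) \<le> real (Suc j) * pi / real (freq m n)"
    by (intro divide_right_mono mult_right_mono) auto
  ultimately show ?thesis unfolding cell_def by simp
qed

text \<open>A step function recording, for the cell containing \<open>u\<close>, the shortfall from
  one zero per cell. It turns the count of zeros into an integral to which limit theorems
  apply.\<close>

definition defect :: "nat \<Rightarrow> nat \<Rightarrow> real \<Rightarrow> real" where
  "defect m n u = (\<Sum>j<freq m n. (1 - real (weight m n (cell m n j))) * indicator (cell m n j) u)"

lemma defect_eq:
  assumes "m > 1" "j < freq m n" "u \<in> cell m n j"
  shows "defect m n u = 1 - real (weight m n (cell m n j))"
proof -
  have "defect m n u = (\<Sum>i<freq m n. if i = j then 1 - real (weight m n (cell m n j)) else 0)"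
    unfolding defect_def
  proof (intro sum.cong refl)
    fix i
    have "i = j" if "u \<in> cell m n i" using cell_unique[OF assms(1) that assms(3)] .
    then show "(1 - real (weight m n (cell m n i))) * indicator (cell m n i) u =
        (if i = j then 1 - real (weight m n (cell m n j)) else 0)"
      using assms(3) by (cases "i = j") (auto simp: indicator_def)
  qed
  then show ?thesis using assms by simp
qed

lemma defect_outside:
  assumes "m > 1" "u \<notin> {0..<pi}"
  shows "defect m n u = 0"
  unfolding defect_def
proof (intro sum.neutral ballI)
  fix j assume "j \<in> {..<freq m n}"
  then have "u \<notin> cell m n j" using cell_subset[OF assms(1), of j n] assms(2) by blast
  then show "(1 - real (weight m n (cell m n j))) * indicator (cell m n j) u = 0" by simp
qed

lemma integral_defect:
  assumes "m > 1"
  shows "(\<integral>u. defect m n u \<partial>lborel) = pi * (1 - real (weight m n {0..<pi}) / real (freq m n))"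
proof -
  have M: "real (freq m n) > 0" using freq_pos[OF assms, of n] by simp
  have [simp]: "integrable lborel (indicat_real (cell m n j))" for j
    unfolding cell_def by (intro integrable_real_indicator emeasure_bounded_finite) auto
  have "(\<integral>u. defect m n u \<partial>lborel)
      = (\<Sum>j<freq m n. (1 - real (weight m n (cell m n j))) * (pi / real (freq m n)))"
    unfolding defect_def by (subst Bochner_Integration.integral_sum) (simp_all add: measure_cell[OF assms])
  also have "\<dots> = (real (freq m n) - real (weight m n {0..<pi})) * (pi / real (freq m n))"
    by (simp add: weight_total[OF assms] sum_subtractf sum_distrib_right[symmetric] del: times_divide_eq_right)
  also have "\<dots> = pi * (1 - real (weight m n {0..<pi}) / real (freq m n))"
    using M by (simp add: field_simps)
  finally show ?thesis .
qed

text \<open>The cell around \<open>u\<close> eventually has weight 0 or 1 according to the side of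
  the level on which \<open>u\<close> lies, so the sequence is eventually constant.\<close>

lemma defect_tendsto:
  assumes m: "m > 1" and u: "u \<notin> {0..<pi} \<or> 2 * \<bar>dkernel m u\<bar> \<noteq> 1"
  shows "(\<lambda>n. defect m n u) \<longlonglongrightarrow> indicator (gap_set m) u"
proof (cases "u \<in> {0..<pi}")
  case False
  then have "defect m n u = 0" for n using defect_outside[OF m] by blast
  moreover have "u \<notin> gap_set m" using False by (auto simp: gap_set_def)
  ultimately show ?thesis by simp
next
  case True
  have "eventually (\<lambda>n. defect m n u = indicator (gap_set m) u) sequentially"
  proof (cases "2 * \<bar>dkernel m u\<bar> < 1")
    case c: True
    show ?thesis
      using weight_cell_eventually_0[OF m c]
    proof eventually_elim
      case (elim n)
      obtain j where j: "j < freq m n" "u \<in> cell m n j" using exists_cell[OF m True] by blast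
      then show ?case using defect_eq[OF m j] elim c True by (simp add: gap_set_def)
    qed
  next
    case c: False
    then have "2 * \<bar>dkernel m u\<bar> > 1" using u True by auto
    from weight_cell_eventually_1[OF m this] show ?thesis
    proof eventually_elim
      case (elim n)
      obtain j where j: "j < freq m n" "u \<in> cell m n j" using exists_cell[OF m True] by blast
      then show ?case using defect_eq[OF m j] elim c True by (simp add: gap_set_def)
    qed
  qed
  then show ?thesis by (rule tendsto_eventually)
qed

text \<open>Dominated convergence: the majorant comes from \<open>weight_cell_le\<close>, and the
  exceptional points form a finite set.\<close>

lemma integral_defect_tendsto:
  assumes m: "m > 1"
  shows "(\<lambda>n. \<integral>u. defect m n u \<partial>lborel) \<longlonglongrightarrow> measure lborel (gap_set m)"
proof -
  \<comment> \<open>The bound 9 is available once \<open>freq m n\<close> is large; the sequence is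
    shifted by \<open>N\<close> to have it at every index.\<close>
  obtain N where N: "\<And>n. n \<ge> N \<Longrightarrow> real (freq m n) \<ge> 32 * real m ^ 3"
    using eventually_freq_ge[of "32 * real m ^ 3" m] by (auto simp: eventually_sequentially)
  have null: "{u \<in> {0..<pi}. 2 * \<bar>dkernel m u\<bar> = 1} \<in> null_sets lborel"
  proof (rule finite_imp_null_set_lborel, rule finite_subset)
    show "{u \<in> {0..<pi}. 2 * \<bar>dkernel m u\<bar> = 1} \<subseteq>
        {u \<in> {0..<pi}. 2 * dkernel m u = 1} \<union> {u \<in> {0..<pi}. 2 * dkernel m u = - 1}"
      by auto
    show "finite ({u \<in> {0..<pi}. 2 * dkernel m u = 1} \<union> {u \<in> {0..<pi}. 2 * dkernel m u = - 1})"
      using finite_dkernel_level[OF m] by simp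
  qed
  have bound: "norm (defect m (n + N) u) \<le> 9 * indicator {0..<pi} u" for n u
  proof (cases "u \<in> {0..<pi}")
    case True
    obtain j where j: "j < freq m (n + N)" "u \<in> cell m (n + N) j" using exists_cell[OF m True] by blast
    show ?thesis using defect_eq[OF m j] weight_cell_le[OF m N j(1)] True by simp
  qed (use defect_outside[OF m] in simp)
  have "(\<lambda>n. \<integral>u. defect m (n + N) u \<partial>lborel) \<longlonglongrightarrow> (\<integral>u. indicator (gap_set m) u \<partial>lborel)"
  proof (rule integral_dominated_convergence[where w = "\<lambda>u. 9 * indicator {0..<pi} u"])
    show "AE u in lborel. (\<lambda>n. defect m (n + N) u) \<longlonglongrightarrow> indicator (gap_set m) u"
      by (rule AE_I'[OF null]) (use LIMSEQ_ignore_initial_segment[OF defect_tendsto[OF m]] in auto)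
    show "integrable lborel (\<lambda>u. 9 * indicator {0..<pi} u :: real)"
      by (intro integrable_mult_right integrable_real_indicator emeasure_bounded_finite) auto
    show "(\<lambda>u. defect m (n + N) u) \<in> borel_measurable lborel" for n
      unfolding defect_def cell_def by measurable
    show "AE u in lborel. norm (defect m (n + N) u) \<le> 9 * indicator {0..<pi} u" for n
      using bound by simp
  qed measurable
  then show ?thesis by (simp add: LIMSEQ_offset)
qed

section \<open>From zeros on the circle to the limit of \<open>C\<close>\<close>

lemma C_H_eq:
  assumes m: "m > 1" and n: "n \<ge> 1"
  shows "C (H m n) = 1 - real (weight m n {0..<pi}) / real (2 * n + 2 * m - 2)"
proof -
  let ?p = "H m n"
  have p0: "?p \<noteq> 0" using m by (intro H_nonzero) simp
  have fin: "finite {z. poly ?p z = 0}" by (rule poly_roots_finite[OF p0])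
  let ?off = "{z. poly ?p z = 0 \<and> cmod z \<noteq> 1}" and ?on = "{z. poly ?p z = 0 \<and> cmod z = 1}"
  \<comment> \<open>By the fundamental theorem of algebra the multiplicities add up to the degree,
    so counting the roots on the circle determines the number off it.\<close>
  have "(\<Sum>z | poly ?p z = 0. order z ?p) = degree ?p"
    using size_proots_complex[of ?p] p0 by (simp add: size_multiset_overloaded_eq)
  also have "{z. poly ?p z = 0} = ?off \<union> ?on" by auto
  also have "(\<Sum>z\<in>?off \<union> ?on. order z ?p) = (\<Sum>z\<in>?off. order z ?p) + (\<Sum>z\<in>?on. order z ?p)"
    by (intro sum.union_disjoint finite_subset[OF _ fin]) auto
  also have "(\<Sum>z\<in>?on. order z ?p) = weight m n {0..<pi}"
  proof -
    \<comment> \<open>The argument of a point on the circle is taken in \<open>[0, 2 * pi)\<close>;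
      half of it is the parameter \<open>u\<close>.\<close>
    have "?on = (\<lambda>u. cis (2 * u)) ` {u. u \<in> {0..<pi} \<and> trig m n u = 0}"
    proof (intro equalityI subsetI)
      fix z assume z: "z \<in> ?on"
      then have "(Re z)\<^sup>2 + (Im z)\<^sup>2 = 1" using cmod_power2[of z] by simp
      then obtain t where "0 \<le> t" "t < 2 * pi" "Re z = cos t" "Im z = sin t"
        using sincos_total_2pi by blast
      then have "0 \<le> t" "t < 2 * pi" "z = cis t" by (auto simp: complex_eq_iff)
      then have "z = cis (2 * (t / 2))" "t / 2 \<in> {0..<pi}" by auto
      moreover have "trig m n (t / 2) = 0"
        using z calculation(1) poly_H_cis_eq_0_iff[of m n "t / 2"] m by simp
      ultimately show "z \<in> (\<lambda>u. cis (2 * u)) ` {u. u \<in> {0..<pi} \<and> trig m n u = 0}" by blast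
    qed (use m poly_H_cis_eq_0_iff[of m n] in auto)
    moreover have "inj_on (\<lambda>u. cis (2 * u)) {u. u \<in> {0..<pi} \<and> trig m n u = 0}"
      by (rule inj_on_subset[OF inj_on_cis_double]) auto
    ultimately show ?thesis unfolding weight_def by (simp only:) (simp add: sum.reindex)
  qed
  finally have "real (\<Sum>z\<in>?off. order z ?p) = real (degree ?p) - real (weight m n {0..<pi})"
    by linarith
  moreover have "degree ?p = 2 * n + 2 * m - 2" using degree_H m n by simp
  moreover have "real (2 * n + 2 * m - 2) \<noteq> 0" using m n by simp
  ultimately show ?thesis unfolding C_def by (simp add: diff_divide_distrib)
qed

lemma C_H_tendsto:
  assumes m: "m > 1"
  shows "(\<lambda>n. C (H m n)) \<longlonglongrightarrow> measure lborel (gap_set m) / pi"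
proof -
  let ?r = "\<lambda>n. real (freq m n) / real (2 * n + 2 * m - 2)"
  let ?w = "\<lambda>n. 1 - real (weight m n {0..<pi}) / real (freq m n)"
  have "(\<lambda>n. (\<integral>u. defect m n u \<partial>lborel) / pi) \<longlonglongrightarrow> measure lborel (gap_set m) / pi"
    by (intro tendsto_divide integral_defect_tendsto m tendsto_const) auto
  then have w: "?w \<longlonglongrightarrow> measure lborel (gap_set m) / pi"
    using m by (simp add: integral_defect)
  \<comment> \<open>The degree exceeds the number of cells by the constant \<open>m - 1\<close>,
    which disappears in the limit.\<close>
  have r: "?r \<longlonglongrightarrow> 1"
  proof -
    have "(\<lambda>n. 1 - (real m - 1) / 2 / real (n + (m - 1))) \<longlonglongrightarrow> 1 - 0"
      by (intro tendsto_diff tendsto_const LIMSEQ_ignore_initial_segment lim_const_over_n)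
    moreover have "?r n = 1 - (real m - 1) / 2 / real (n + (m - 1))" for n
      using m by (simp add: freq_def of_nat_diff field_simps)
    ultimately show ?thesis by simp
  qed
  have "(\<lambda>n. 1 - ?r n * (1 - ?w n)) \<longlonglongrightarrow> 1 - 1 * (1 - measure lborel (gap_set m) / pi)"
    by (intro tendsto_intros w r)
  moreover have "eventually (\<lambda>n. 1 - ?r n * (1 - ?w n) = C (H m n)) sequentially"
    using eventually_ge_at_top[of 1]
  proof eventually_elim
    case (elim n)
    have "real (freq m n) \<noteq> 0" using freq_pos[OF m, of n] by simp
    then show ?case using C_H_eq[OF m elim] by simp
  qed
  ultimately show ?thesis by (simp add: tendsto_cong)
qed

section \<open>Bounds for the limiting density\<close>

text \<open>On \<open>{0<..<pi}\<close> the defining inequality is multiplied by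
  \<open>sin u > 0\<close>. The endpoint 0 drops out because the kernel equals \<open>m\<close>
  there.\<close>

lemma gap_set_iff:
  assumes "m > 1"
  shows "u \<in> gap_set m \<longleftrightarrow> u \<in> {0<..<pi} \<and> 2 * \<bar>sin (real m * u)\<bar> < sin u"
proof (cases "u \<in> {0<..<pi}")
  case True
  then have s: "sin u > 0" by (simp add: sin_gt_zero)
  have "2 * \<bar>sin (real m * u)\<bar> = sin u * (2 * \<bar>dkernel m u\<bar>)"
    using s by (simp add: sin_mult_dkernel[symmetric] abs_mult)
  then have "2 * \<bar>sin (real m * u)\<bar> < sin u \<longleftrightarrow> 2 * \<bar>dkernel m u\<bar> < 1"
    using s by (simp add: mult_less_cancel_left_pos[of "sin u" _ 1, simplified])
  then show ?thesis using True by (auto simp: gap_set_def)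
next
  case False
  have "dkernel m 0 = real m" by (simp add: dkernel_def)
  then have "0 \<notin> gap_set m" using assms by (simp add: gap_set_def)
  then show ?thesis using False by (auto simp: gap_set_def order_le_less)
qed

lemma abs_sin_shift: "\<bar>sin (real m * (real k * pi / real m + t))\<bar> = \<bar>sin (real m * t)\<bar>" if "m > 0"
  using that by (simp add: distrib_left sin_add abs_mult)

text \<open>Multiplication by \<open>2 * sin a\<close> with \<open>a = pi / (2 * m)\<close> gives
  differences of cosines at consecutive odd multiples of \<open>a\<close>, telescoping to
  \<open>cos (- a) - cos (pi - a)\<close>. The vanishing term \<open>k = 0\<close> is included for
  the telescoping.\<close>

lemma sum_sin_multiples:
  assumes "m > 1"
  shows "(\<Sum>k\<in>{1..<m}. sin (real k * pi / real m))
    = sin ((real m - 1) * pi / (2 * real m)) / sin (pi / (2 * real m))"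
proof -
  define a where "a = pi / (2 * real m)"
  have a: "0 < a" "a < pi" using assms by (auto simp: a_def field_simps)
  have sa: "sin a > 0" using a by (simp add: sin_gt_zero)
  have "2 * sin a * (\<Sum>k<m. sin (real k * pi / real m))
      = (\<Sum>k<m. cos ((2 * real k - 1) * a) - cos ((2 * real (Suc k) - 1) * a))"
    unfolding sum_distrib_left
  proof (intro sum.cong refl)
    fix k
    have e: "(2 * real k - 1) * a = real k * pi / real m - a" "(2 * real (Suc k) - 1) * a = real k * pi / real m + a"
      using assms by (simp_all add: a_def field_simps)
    show "2 * sin a * sin (real k * pi / real m) = cos ((2 * real k - 1) * a) - cos ((2 * real (Suc k) - 1) * a)"
      unfolding e cos_add cos_diff by simp
  qed
  also have "\<dots> = cos (- a) - cos ((2 * real m - 1) * a)"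
    by (subst sum_lessThan_telescope') simp
  also have "(2 * real m - 1) * a = pi - a" using assms by (simp add: a_def field_simps)
  also have "cos (- a) - cos (pi - a) = 2 * cos a" by simp
  also have "cos a = sin ((real m - 1) * pi / (2 * real m))"
  proof -
    have "(real m - 1) * pi / (2 * real m) = pi / 2 - a" using assms by (simp add: a_def field_simps)
    then show ?thesis by (simp add: sin_diff)
  qed
  finally have "sin a * (\<Sum>k<m. sin (real k * pi / real m)) = sin ((real m - 1) * pi / (2 * real m))"
    by simp
  moreover have "(\<Sum>k<m. sin (real k * pi / real m)) = (\<Sum>k\<in>{1..<m}. sin (real k * pi / real m))"
    using assms by (intro sum.mono_neutral_right) (auto simp: Suc_le_eq)
  ultimately show ?thesis using sa unfolding a_def[symmetric]
    by (metis less_irrefl nonzero_mult_div_cancel_left)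
qed

section \<open>Decomposition into windows centred at the zeros of \<open>sin (m * u)\<close>\<close>

definition window :: "nat \<Rightarrow> nat \<Rightarrow> real set" where
  "window m k = {real k * pi / real m - pi / (2 * real m) ..< real k * pi / real m + pi / (2 * real m)}"

lemma mem_window_iff:
  assumes "m > 1"
  shows "u \<in> window m k \<longleftrightarrow> real k - 1 / 2 \<le> real m * u / pi \<and> real m * u / pi < real k + 1 / 2"
  using assms by (auto simp: window_def field_simps)

lemma window_disjoint: "m > 1 \<Longrightarrow> u \<in> window m i \<Longrightarrow> u \<in> window m j \<Longrightarrow> i = j"
  unfolding mem_window_iff by linarith

lemma sin_le_sin_multiple:
  assumes "m > 1" "0 < v" "v \<le> pi / (2 * real m)"
  shows "sin v \<le> sin (real m * v)"
proof -
  have "real m * v \<le> pi / 2" using assms by (simp add: field_simps)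
  moreover have "v \<le> real m * v" using assms by simp
  ultimately show ?thesis using assms pi_gt_zero by (intro sin_monotone_2pi_le) linarith+
qed

text \<open>The windows miss only the two end pieces of length \<open>pi / (2 * m)\<close>. On the
  left one \<open>sin u \<le> sin (m * u)\<close> contradicts membership, and the reflection
  \<open>pi - u\<close> reduces the right one to it.\<close>

lemma gap_set_subset_windows:
  assumes m: "m > 1"
  shows "gap_set m \<subseteq> (\<Union>k\<in>{1..<m}. window m k)"
proof
  fix u assume "u \<in> gap_set m"
  then have u: "0 < u" "u < pi" and less: "2 * \<bar>sin (real m * u)\<bar> < sin u"
    by (simp_all add: gap_set_iff[OF m])
  have not_small: "\<not> v \<le> pi / (2 * real m)"
    if "0 < v" "v < pi" "2 * \<bar>sin (real m * v)\<bar> < sin v" for v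
    using sin_le_sin_multiple[OF m that(1)] that sin_gt_zero[of v] by linarith
  \<comment> \<open>The nearest integer to \<open>m * u / pi\<close>, with ties rounded up to match
    the half-open windows.\<close>
  define k where "k = nat \<lfloor>real m * u / pi + 1 / 2\<rfloor>"
  have nn: "real m * u / pi + 1 / 2 \<ge> 0" using u by simp
  have k: "real k - 1 / 2 \<le> real m * u / pi" "real m * u / pi < real k + 1 / 2"
    using nn unfolding k_def by linarith+
  have "real m * u / pi > 1 / 2"
    using not_small[OF u less] m by (simp add: field_simps)
  then have "k \<ge> 1" using k by linarith
  have "\<bar>sin (real m * (pi - u))\<bar> = \<bar>sin (real m * u)\<bar>"
    by (simp add: right_diff_distrib sin_diff abs_mult)
  then have "\<not> pi - u \<le> pi / (2 * real m)" using not_small[of "pi - u"] u less by simp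
  then have "real m * u / pi < real m - 1 / 2" using m by (simp add: field_simps)
  then have "k < m" using k by linarith
  with \<open>k \<ge> 1\<close> show "u \<in> (\<Union>k\<in>{1..<m}. window m k)"
    using k mem_window_iff[OF m] by auto
qed

lemma finite_measure_gap_set: "emeasure lborel (gap_set m \<inter> S) < \<infinity>"
  by (rule emeasure_bounded_finite, rule bounded_subset[of "{0..pi}"]) (auto simp: gap_set_def)

lemma measure_gap_set_eq_sum:
  assumes m: "m > 1"
  shows "measure lborel (gap_set m) = (\<Sum>k\<in>{1..<m}. measure lborel (gap_set m \<inter> window m k))"
proof -
  have [measurable]: "window m k \<in> sets borel" for k by (simp add: window_def)
  have "gap_set m = (\<Union>k\<in>{1..<m}. gap_set m \<inter> window m k)"
    using gap_set_subset_windows[OF m] by blast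
  also have "measure lborel \<dots> = (\<Sum>k\<in>{1..<m}. measure lborel (gap_set m \<inter> window m k))"
  proof (rule measure_finite_Union)
    show "disjoint_family_on (\<lambda>k. gap_set m \<inter> window m k) {1..<m}"
      using window_disjoint[OF m] unfolding disjoint_family_on_def by blast
    show "emeasure lborel (gap_set m \<inter> window m k) \<noteq> \<infinity>" for k
      using finite_measure_gap_set[of m "window m k"] by simp
  qed auto
  finally show ?thesis .
qed

lemma node_bounds:
  assumes "k \<in> {1..<m}"
  shows "pi / real m \<le> real k * pi / real m" "real k * pi / real m \<le> pi - pi / real m"
    "0 < sin (real k * pi / real m)"
proof -
  have m: "real m > 0" "real k \<ge> 1" "real k + 1 \<le> real m" using assms by auto
  then show a: "pi / real m \<le> real k * pi / real m" by (simp add: field_simps)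
  have "(real k + 1) * pi \<le> real m * pi" using m by (intro mult_right_mono) auto
  then show b: "real k * pi / real m \<le> pi - pi / real m" using m by (simp add: field_simps)
  have "pi / real m > 0" using m by simp
  then show "0 < sin (real k * pi / real m)" using a b by (intro sin_gt_zero) linarith+
qed

section \<open>Lower bound in one window\<close>

lemma abs_sin_less: "t \<noteq> 0 \<Longrightarrow> \<bar>sin t\<bar> < \<bar>t\<bar>" for t :: real
proof -
  assume "t \<noteq> 0"
  have pos: "\<bar>sin x\<bar> < x" if x: "x > 0" for x :: real
  proof (cases "x > 1")
    case True
    then show ?thesis using abs_sin_le_one[of x] by linarith
  next
    case False
    obtain z where z: "0 < z" "z < x" "sin x - sin 0 = (x - 0) * cos z"
      using MVT2[of 0 x sin cos] x by auto
    have "cos z < cos 0" using z False pi_gt3 by (intro cos_monotone_0_pi) linarith+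
    then have "x * cos z < x * 1" using x by (intro mult_strict_left_mono) simp_all
    moreover have "sin x > 0" using x False pi_gt3 by (intro sin_gt_zero) linarith+
    ultimately show ?thesis using z by simp
  qed
  show ?thesis using pos[of t] pos[of "- t"] \<open>t \<noteq> 0\<close> by (cases "t > 0") auto
qed

lemma measure_gap_set_window_gt:
  assumes m: "m > 1" and k: "k \<in> {1..<m}"
  shows "2 * sin (real k * pi / real m) / (2 * real m + 1) < measure lborel (gap_set m \<inter> window m k)"
proof -
  define c where "c = real k * pi / real m"
  define s where "s = sin c"
  \<comment> \<open>Chosen so that \<open>2 * m * \<rho> = s - \<rho>\<close>: for
    \<open>\<bar>t\<bar> \<le> \<rho>\<close> the left side bounds
    \<open>2 * \<bar>sin (m * t)\<bar>\<close> from above, the right side bounds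
    \<open>sin (c + t)\<close> from below.\<close>
  define \<rho> where "\<rho> = s / (2 * real m + 1)"
  have c: "pi / real m \<le> c" "c \<le> pi - pi / real m" and s: "s > 0"
    using node_bounds[OF k] by (simp_all add: c_def s_def)
  have \<rho>: "\<rho> > 0" "s - \<rho> = 2 * real m * \<rho>" using s by (simp_all add: \<rho>_def field_simps)
  have "\<rho> \<le> 1 / (2 * real m + 1)" unfolding \<rho>_def by (intro divide_right_mono) (simp_all add: s_def)
  also have "\<dots> < pi / (2 * real m)"
  proof -
    have "1 / (2 * real m + 1) < 1 / (2 * real m)" using m by (simp add: field_simps)
    also have "\<dots> \<le> pi / (2 * real m)" using pi_gt3 by (intro divide_right_mono) auto
    finally show ?thesis .
  qed
  finally have \<rho>w: "\<rho> < pi / (2 * real m)" .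
  have half: "pi / (2 * real m) = pi / real m / 2" "pi / real m > 0" using m by simp_all
  have inside: "c + t \<in> gap_set m" if t: "\<bar>t\<bar> \<le> \<rho>" for t
    unfolding gap_set_iff[OF m]
  proof
    show "c + t \<in> {0<..<pi}" using t \<rho>w c half unfolding greaterThanLessThan_iff by linarith
    have eq: "\<bar>sin (real m * (c + t))\<bar> = \<bar>sin (real m * t)\<bar>"
      unfolding c_def using m by (intro abs_sin_shift) simp
    have "\<bar>sin (c + t) - sin c\<bar> \<le> \<bar>t\<bar>"
      using field_differentiable_bound[of UNIV sin cos 1 c "c + t"] DERIV_sin by simp
    then have lo: "sin (c + t) \<ge> s - \<bar>t\<bar>" unfolding s_def by linarith
    show "2 * \<bar>sin (real m * (c + t))\<bar> < sin (c + t)"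
    proof (cases "t = 0")
      case True
      then show ?thesis unfolding eq using s by (simp add: s_def)
    next
      case False
      have "2 * \<bar>sin (real m * t)\<bar> < 2 * \<bar>real m * t\<bar>" using False m abs_sin_less[of "real m * t"] by simp
      also have "\<dots> \<le> 2 * real m * \<rho>" using t m by (simp add: abs_mult)
      also have "\<dots> \<le> sin (c + t)" using lo t \<rho>(2) by linarith
      finally show ?thesis unfolding eq .
    qed
  qed
  \<comment> \<open>The interval of radius \<open>\<rho>\<close> alone gives a weak inequality.
    Since \<open>gap_set m\<close> is open, it also contains points just beyond
    \<open>c + \<rho>\<close>, which makes the bound strict.\<close>
  have "open {u \<in> {0<..<pi}. 2 * \<bar>sin (real m * u)\<bar> < sin u}"
    unfolding greaterThanLessThan_iff by (intro open_Collect_conj open_Collect_less continuous_intros)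
  then have "open (gap_set m)"
    using gap_set_iff[OF m] by (metis (no_types, lifting) Collect_cong Collect_mem_eq)
  then obtain e where e: "e > 0" "ball (c + \<rho>) e \<subseteq> gap_set m"
    using inside[of \<rho>] \<rho> by (metis abs_of_pos openE order_refl)
  define \<epsilon> where "\<epsilon> = min (e / 2) (pi / (2 * real m) - \<rho>)"
  have \<epsilon>: "\<epsilon> > 0" "\<epsilon> < e" "\<rho> + \<epsilon> \<le> pi / (2 * real m)" using e \<rho>w by (auto simp: \<epsilon>_def min_def)
  have sub: "{c - \<rho>..<c + \<rho> + \<epsilon>} \<subseteq> gap_set m \<inter> window m k"
  proof
    fix u assume u: "u \<in> {c - \<rho>..<c + \<rho> + \<epsilon>}"
    have "u \<in> window m k" using u \<epsilon> \<rho>w unfolding window_def c_def[symmetric] by auto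
    moreover have "u \<in> gap_set m"
    proof (cases "u \<le> c + \<rho>")
      case True
      then show ?thesis using inside[of "u - c"] u by auto
    next
      case False
      then show ?thesis using e \<epsilon> u by (auto simp: subset_iff dist_real_def)
    qed
    ultimately show "u \<in> gap_set m \<inter> window m k" by blast
  qed
  have [measurable]: "window m k \<in> sets borel" by (simp add: window_def)
  have "2 * s / (2 * real m + 1) < 2 * \<rho> + \<epsilon>" using \<epsilon> by (simp add: \<rho>_def)
  also have "\<dots> = measure lborel {c - \<rho>..<c + \<rho> + \<epsilon>}" using \<epsilon> \<rho> by simp
  also have "\<dots> \<le> measure lborel (gap_set m \<inter> window m k)"
    using finite_measure_gap_set[of m "window m k"] sub
    by (intro measure_mono_fmeasurable fmeasurableI) auto
  finally show ?thesis by (simp add: s_def c_def)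
qed

section \<open>Upper bound in one window\<close>

lemma sin_ge_chord:
  fixes x :: real
  assumes "0 \<le> x" "x \<le> pi / 6"
  shows "x \<le> pi / 3 * sin x"
proof (cases "x = 0 \<or> x = pi / 6")
  case True
  then show ?thesis
  proof
    assume "x = pi / 6"
    then show ?thesis using sin_30 by (simp only:)
  qed simp
next
  case False
  then have x: "0 < x" "x < pi / 6" using assms by auto
  obtain y where y: "0 < y" "y < x" "sin x - sin 0 = (x - 0) * cos y"
    using MVT2[of 0 x sin cos] x by auto
  obtain z where z: "x < z" "z < pi / 6" "sin (pi / 6) - sin x = (pi / 6 - x) * cos z"
    using MVT2[of x "pi / 6" sin cos] x by auto
  \<comment> \<open>Concavity: the mean slope of the sine on \<open>[x, pi / 6]\<close> is at most
    that on \<open>[0, x]\<close>. As \<open>sin (pi / 6) = 1 / 2\<close>, the chord has slope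
    \<open>3 / pi\<close>.\<close>
  have "cos z \<le> cos y" using x y z pi_gt_zero by (intro cos_monotone_0_pi_le) linarith+
  then have "x * ((pi / 6 - x) * cos z) \<le> x * ((pi / 6 - x) * cos y)"
    using x by (intro mult_left_mono) auto
  then have "x * (1 / 2 - sin x) \<le> (pi / 6 - x) * sin x"
    using y z by (simp add: sin_30 mult_ac)
  then show ?thesis by (simp add: algebra_simps)
qed

text \<open>Concavity of the sine on \<open>[0, pi]\<close>: the mean value theorem on either side
  of \<open>c\<close>, with the cosine decreasing.\<close>

lemma sin_le_tangent:
  assumes "0 \<le> c" "c \<le> pi" "0 \<le> c + t" "c + t \<le> pi"
  shows "sin (c + t) \<le> sin c + t * cos c"
proof -
  consider "t = 0" | "t > 0" | "t < 0" by linarith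
  then show ?thesis
  proof cases
    case 2
    then obtain z where z: "c < z" "z < c + t" "sin (c + t) - sin c = (c + t - c) * cos z"
      using MVT2[of c "c + t" sin cos] by auto
    have "(c + t - c) * cos z \<le> t * cos c"
      unfolding add_diff_cancel_left' using 2 z assms by (intro mult_left_mono cos_monotone_0_pi_le) linarith+
    then show ?thesis using z(3) by linarith
  next
    case 3
    then obtain z where z: "c + t < z" "z < c" "sin c - sin (c + t) = (c - (c + t)) * cos z"
      using MVT2[of "c + t" c sin cos] by auto
    have "t * cos z \<le> t * cos c"
      using 3 z assms by (intro mult_left_mono_neg cos_monotone_0_pi_le) linarith+
    moreover have "(c - (c + t)) * cos z = - (t * cos z)" by simp
    ultimately show ?thesis using z(3) by linarith
  qed simp
qed

text \<open>For \<open>u = c + t\<close> in the set, the chord below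
  \<open>sin (m * \<bar>t\<bar>)\<close> and the tangent above \<open>sin u\<close> give
  \<open>m * \<bar>t\<bar> \<le> P * s + t * \<kappa>\<close>. Solving for each sign of
  \<open>t\<close> gives the endpoints \<open>\<alpha>\<close> and \<open>\<beta>\<close>.\<close>

lemma measure_gap_set_window_less:
  assumes m: "m > 1" and k: "k \<in> {1..<m}"
  shows "measure lborel (gap_set m \<inter> window m k) < 2 * pi * sin (real k * pi / real m) / (6 * real m - pi)"
proof -
  define c where "c = real k * pi / real m"
  define s where "s = sin c"
  define P where "P = pi / 6"
  define \<kappa> where "\<kappa> = P * cos c"
  have "pi / real m > 0" using m by simp
  then have c: "0 \<le> c" "c \<le> pi" and s: "s > 0"
    using node_bounds[OF k] unfolding c_def s_def by linarith+
  have P: "0 < P" "P < 1" using pi_less_4 by (simp_all add: P_def)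
  have "\<bar>\<kappa>\<bar> \<le> P * 1" unfolding \<kappa>_def abs_mult using P by (intro mult_mono) auto
  then have \<kappa>: "\<bar>\<kappa>\<bar> \<le> P" by simp
  have pos: "real m - \<kappa> > 0" "real m + \<kappa> > 0" "real m - P > 0" using \<kappa> P m by linarith+
  define \<alpha> where "\<alpha> = P * s / (real m - \<kappa>)"
  define \<beta> where "\<beta> = P * s / (real m + \<kappa>)"
  have sub: "gap_set m \<inter> window m k \<subseteq> {c - \<beta>..c + \<alpha>}"
  proof
    fix u assume u: "u \<in> gap_set m \<inter> window m k"
    define t where "t = u - c"
    have ut: "u = c + t" by (simp add: t_def)
    have ub: "0 < u" "u < pi" and less: "2 * \<bar>sin (real m * u)\<bar> < sin u"
      using u by (simp_all add: gap_set_iff[OF m])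
    have "\<bar>t\<bar> \<le> pi / (2 * real m)"
      using u unfolding window_def c_def[symmetric] t_def by (auto simp: abs_le_iff)
    then have mt: "0 \<le> real m * \<bar>t\<bar>" "real m * \<bar>t\<bar> \<le> pi / 2" using m by (simp_all add: field_simps)
    have eq: "\<bar>sin (real m * u)\<bar> = \<bar>sin (real m * t)\<bar>"
      unfolding ut c_def using m by (intro abs_sin_shift) simp
    have "\<bar>sin (real m * t)\<bar> = \<bar>sin (real m * \<bar>t\<bar>)\<bar>" by (cases "t \<ge> 0") auto
    also have "\<dots> = sin (real m * \<bar>t\<bar>)" using mt pi_gt_zero by (intro abs_of_nonneg sin_ge_zero) linarith+
    finally have y: "2 * sin (real m * \<bar>t\<bar>) < sin u" using less eq by simp
    \<comment> \<open>Beyond \<open>pi / 6\<close> the left side of \<open>y\<close> would be at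
      least 1; this brings \<open>t\<close> into the range of \<open>sin_ge_chord\<close>.\<close>
    have "real m * \<bar>t\<bar> \<le> pi / 6"
    proof (rule ccontr)
      assume "\<not> ?thesis"
      then have "sin (pi / 6) \<le> sin (real m * \<bar>t\<bar>)"
        using mt pi_gt_zero by (intro sin_monotone_2pi_le) linarith+
      then show False using y sin_le_one[of u] by (simp add: sin_30)
    qed
    then have "real m * \<bar>t\<bar> \<le> pi / 3 * sin (real m * \<bar>t\<bar>)" using mt by (intro sin_ge_chord) auto
    also have "\<dots> = P * (2 * sin (real m * \<bar>t\<bar>))" by (simp add: P_def)
    also have "\<dots> \<le> P * sin u" using y P by (intro mult_left_mono) auto
    also have "\<dots> \<le> P * (s + t * cos c)"
      unfolding ut s_def using P c ub by (intro mult_left_mono sin_le_tangent) (auto simp: t_def)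
    also have "\<dots> = P * s + t * \<kappa>" by (simp add: \<kappa>_def algebra_simps)
    finally have main: "real m * \<bar>t\<bar> \<le> P * s + t * \<kappa>" .
    have "P * s > 0" using P s by simp
    then have nn: "\<alpha> \<ge> 0" "\<beta> \<ge> 0" using pos unfolding \<alpha>_def \<beta>_def by simp_all
    have "- \<beta> \<le> t \<and> t \<le> \<alpha>"
    proof (cases "t \<ge> 0")
      case True
      then have "t * (real m - \<kappa>) \<le> P * s" using main by (simp add: algebra_simps)
      then have "t \<le> \<alpha>" using pos by (simp add: \<alpha>_def pos_le_divide_eq)
      then show ?thesis using True nn by simp
    next
      case False
      then have "(- t) * (real m + \<kappa>) \<le> P * s" using main by (simp add: algebra_simps)
      then have "- t \<le> \<beta>" using pos by (simp add: \<beta>_def pos_le_divide_eq)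
      then show ?thesis using False nn by simp
    qed
    then show "u \<in> {c - \<beta>..c + \<alpha>}" by (simp add: ut)
  qed
  have [measurable]: "window m k \<in> sets borel" by (simp add: window_def)
  have "P * s > 0" using P s by simp
  then have nn: "\<alpha> \<ge> 0" "\<beta> \<ge> 0" using pos unfolding \<alpha>_def \<beta>_def by simp_all
  have "measure lborel (gap_set m \<inter> window m k) \<le> measure lborel {c - \<beta>..c + \<alpha>}"
    using sub by (intro measure_mono_fmeasurable fmeasurableI emeasure_bounded_finite) auto
  also have "\<dots> = \<alpha> + \<beta>" using nn by simp
  also have "\<dots> = P * s * (1 / (real m - \<kappa>) + 1 / (real m + \<kappa>))"
    by (simp add: \<alpha>_def \<beta>_def distrib_left)
  also have "\<dots> < P * s * (2 / (real m - P))"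
  proof (rule mult_strict_left_mono[OF _ \<open>P * s > 0\<close>])
    \<comment> \<open>The estimate rests on
      \<open>m * (m - P) < m ^ 2 - P ^ 2 \<le> m ^ 2 - \<kappa> ^ 2\<close>; it is strict because
      \<open>0 < P < m\<close>, and it removes the dependence on \<open>cos c\<close>.\<close>
    have "\<kappa>\<^sup>2 \<le> P\<^sup>2" using \<kappa> P by (intro power2_le_iff_abs_le[THEN iffD2]) auto
    moreover have "P\<^sup>2 < real m * P" using P m by (simp add: power2_eq_square)
    ultimately have "2 * real m * (real m - P) < 2 * ((real m - \<kappa>) * (real m + \<kappa>))"
      by (simp add: algebra_simps power2_eq_square)
    moreover have "1 / (real m - \<kappa>) + 1 / (real m + \<kappa>) = 2 * real m / ((real m - \<kappa>) * (real m + \<kappa>))"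
      using pos by (simp add: add_divide_eq_if_simps)
    ultimately show "1 / (real m - \<kappa>) + 1 / (real m + \<kappa>) < 2 / (real m - P)"
      using pos by (simp add: divide_less_eq less_divide_eq)
  qed
  also have "\<dots> = 2 * pi * s / (6 * real m - pi)"
    using pos(3) by (simp add: P_def field_simps)
  finally show ?thesis by (simp add: s_def c_def)
qed

text \<open>Convergence is part of the conclusion because \<open>lim\<close> carries no information
  about a divergent sequence.\<close>

theorem theorem5:
  fixes m :: nat
  assumes "m > 1"
  shows "convergent (\<lambda>n. C (H m n)) \<and>
    2 / (pi * (2 * real m + 1)) * (sin ((real m - 1) * pi / (2 * real m)) / sin (pi / (2 * real m))) < LC m \<and>
    LC m < 2 / (6 * real m - pi) * (sin ((real m - 1) * pi / (2 * real m)) / sin (pi / (2 * real m)))"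
proof -
  let ?s = "\<lambda>k. sin (real k * pi / real m)"
  let ?\<mu> = "measure lborel (gap_set m)"
  have lim: "LC m = ?\<mu> / pi" unfolding LC_def by (rule limI[OF C_H_tendsto[OF assms]])
  \<comment> \<open>Nonempty index sets preserve the strict inequalities under summation.\<close>
  have ne: "{1..<m} \<noteq> {}" using assms by simp
  have "(\<Sum>k\<in>{1..<m}. 2 * ?s k / (2 * real m + 1)) < ?\<mu>"
    unfolding measure_gap_set_eq_sum[OF assms]
    using ne by (intro sum_strict_mono measure_gap_set_window_gt[OF assms]) auto
  then have lo: "2 / (2 * real m + 1) * (\<Sum>k\<in>{1..<m}. ?s k) < ?\<mu>"
    by (simp add: sum_distrib_left)
  have "?\<mu> < (\<Sum>k\<in>{1..<m}. 2 * pi * ?s k / (6 * real m - pi))"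
    unfolding measure_gap_set_eq_sum[OF assms]
    using ne by (intro sum_strict_mono measure_gap_set_window_less[OF assms]) auto
  then have hi: "?\<mu> < 2 * pi / (6 * real m - pi) * (\<Sum>k\<in>{1..<m}. ?s k)"
    by (simp add: sum_distrib_left)
  have "2 / (pi * (2 * real m + 1)) * S < ?\<mu> / pi" if "2 / (2 * real m + 1) * S < ?\<mu>" for S
    using divide_strict_right_mono[OF that pi_gt_zero] by (simp add: mult_ac)
  moreover have "?\<mu> / pi < 2 / (6 * real m - pi) * S" if "?\<mu> < 2 * pi / (6 * real m - pi) * S" for S
    using divide_strict_right_mono[OF that pi_gt_zero] by simp
  ultimately show ?thesis
    using lo hi C_H_tendsto[OF assms] unfolding lim sum_sin_multiples[OF assms]
    by (blast intro: convergentI)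
qed

end
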